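(* Let $X$ be a Banach space containing no subspaces isomorphic to $\ell_1$. Then $$K_{1}(X)\leqslant G(X)\leqslant R(X^{*})\leqslant 8K_{2}(X).$$
   Context: Banach spaces are infinite-dimensional, over the real or complex field; subspaces are closed linear subspaces; $B_X$ denotes the closed unit ball of $X$, and $\mathcal F_X$ the family of all weakly compact subsets of $B_X$. A sequence $(y_n)_{n=1}^\infty$ is a convex block subsequence of $(x_n)_{n=1}^\infty$ if there is a strictly increasing sequence of positive integers $(k_n)_{n=1}^\infty$ such that, with $k_0=0$, $y_n\in\operatorname{conv}\{x_i: k_{n-1}+1\leqslant i\leqslant k_n\}$ for every $n\in\mathbb N$. The collection of all convex block subsequences of $(x_n)$ is denoted $\operatorname{cbs}((x_n)_{n=1}^\infty)$. For a bounded sequence $(f_n)_{n=1}^\infty$ in $X^*$ define $$\alpha((f_n)_{n=1}^\infty)=\sup_{K\in\mathcal F_X}\limsup_{n\to\infty}\sup_{x\in K}|\langle f_n,x\rangle|,$$ $$\beta((f_n)_{n=1}^\infty)=\sup\Big\{\limsup_{n\to\infty}|\langle f_n,x_n\rangle| : (x_n)_{n=1}^\infty\subseteq B_X \text{ weakly null}\Big\}.$$ Define $$K_1(X)=\sup_{(f_n)}\inf_{(g_n)\in\operatorname{cbs}((f_n))}\alpha((g_n)_{n=1}^\infty),\quad K_2(X)=\sup_{(f_n)}\inf_{(g_n)\in\operatorname{cbs}((f_n))}\beta((g_n)_{n=1}^\infty),$$ $$G(X)=\sup_{(f_n)}\inf_{(g_n)\in\operatorname{cbs}((f_n))}\limsup_{n\to\infty}\|g_n\|,$$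 where all three suprema are over all weak$^*$ null sequences $(f_n)_{n=1}^\infty$ in $B_{X^*}$. For a bounded sequence $(x_n)_{n=1}^\infty$ in a Banach space set $\operatorname{ca}((x_n)_{n=1}^\infty)=\inf_{n\in\mathbb N}\sup_{k,l\geqslant n}\|x_k-x_l\|$. For a Banach space $Y$ define $$R(Y)=\sup_{(x_n)_{n=1}^\infty\subseteq B_Y}\ \inf_{(z_n)\in\operatorname{cbs}((x_n))}\operatorname{ca}((z_n)_{n=1}^\infty),$$ where the supremum is over all sequences in $B_Y$. *)

theory Defs
  imports "HOL-Analysis.Analysis"
begin

section \<open>The scalar field\<close>

text \<open>
  The class axiom says that the type is a copy of \<open>\<real>\<close> or of \<open>\<complex>\<close>, as a normed field.
\<close>

class real_or_complex = real_normed_field +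
  assumes real_or_complex:
    "\<exists>\<phi> :: 'a \<Rightarrow> complex.
       (range \<phi> = \<real> \<or> range \<phi> = UNIV) \<and>
       (\<forall>x y. \<phi> (x + y) = \<phi> x + \<phi> y) \<and>
       (\<forall>x y. \<phi> (x * y) = \<phi> x * \<phi> y) \<and>
       (\<forall>r x. \<phi> (r *\<^sub>R x) = r *\<^sub>R \<phi> x) \<and>
       (\<forall>x. norm (\<phi> x) = norm x)"

instance real :: real_or_complex
proof
  have "range complex_of_real = \<real>"
    by (simp add: Reals_def)
  then show "\<exists>\<phi> :: real \<Rightarrow> complex.
       (range \<phi> = \<real> \<or> range \<phi> = UNIV) \<and>
       (\<forall>x y. \<phi> (x + y) = \<phi> x + \<phi> y) \<and>
       (\<forall>x y. \<phi> (x * y) = \<phi> x * \<phi> y) \<and>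
       (\<forall>r x. \<phi> (r *\<^sub>R x) = r *\<^sub>R \<phi> x) \<and>
       (\<forall>x. norm (\<phi> x) = norm x)"
    by (intro exI[of _ complex_of_real]) (simp add: scaleR_conv_of_real)
qed

instance complex :: real_or_complex
  by standard (rule exI[of _ "\<lambda>z. z"], simp)

section \<open>Banach spaces over the scalar field, dual space, weak and weak* topology\<close>

text \<open>
  Norm, completeness and real-linear structure come from the class \<^class>\<open>banach\<close>;
  \<open>smul\<close> is the scalar multiplication over the field, extending \<open>(*\<^sub>R)\<close>.
\<close>

locale banach_space_over = vector_space smul
  for smul :: "'k::real_or_complex \<Rightarrow> 'x::banach \<Rightarrow> 'x" +
  assumes scale_of_real: "smul (of_real r) x = r *\<^sub>R x"
    and norm_scale: "norm (smul c x) = norm c * norm x"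

lemma banach_space_over_real: "banach_space_over (scaleR :: real \<Rightarrow> 'x::banach \<Rightarrow> 'x)"
  by unfold_locales (auto simp: algebra_simps)

lemma banach_space_over_complex: "banach_space_over ((*) :: complex \<Rightarrow> complex \<Rightarrow> complex)"
  by unfold_locales (auto simp: algebra_simps norm_mult scaleR_conv_of_real)

definition infinite_dimensional :: "('k::real_or_complex \<Rightarrow> 'x::banach \<Rightarrow> 'x) \<Rightarrow> bool" where
  "infinite_dimensional smul \<longleftrightarrow> \<not> (\<exists>B. finite B \<and> module.span smul B = UNIV)"

text \<open>
  The elements of \<^typ>\<open>'x \<Rightarrow>\<^sub>L 'k\<close> are bounded and real-linear only, so over the complex numbers
  the dual is a proper subspace. Its norm is the operator norm.
\<close>

definition dual :: "('k::real_or_complex \<Rightarrow> 'x::banach \<Rightarrow> 'x) \<Rightarrow> ('x \<Rightarrow>\<^sub>L 'k) set" where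
  "dual smul = {f. \<forall>c x. blinfun_apply f (smul c x) = c * blinfun_apply f x}"

definition weak_topology :: "('k::real_or_complex \<Rightarrow> 'x::banach \<Rightarrow> 'x) \<Rightarrow> 'x topology" where
  "weak_topology smul =
     topology_generated_by {blinfun_apply f -` U | f U. f \<in> dual smul \<and> open U}"

text \<open>
  \<^const>\<open>strong_operator_topology\<close> is the topology of pointwise convergence; for
  functionals this is the weak* topology.
\<close>

definition weak_star_topology ::
    "('k::real_or_complex \<Rightarrow> 'x::banach \<Rightarrow> 'x) \<Rightarrow> ('x \<Rightarrow>\<^sub>L 'k) topology" where
  "weak_star_topology smul = subtopology strong_operator_topology (dual smul)"

definition weakly_compact_sets :: "('k::real_or_complex \<Rightarrow> 'x::banach \<Rightarrow> 'x) \<Rightarrow> 'x set set" where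
  "weakly_compact_sets smul = {K. K \<subseteq> cball 0 1 \<and> compactin (weak_topology smul) K}"

definition weakly_null_seqs ::
    "('k::real_or_complex \<Rightarrow> 'x::banach \<Rightarrow> 'x) \<Rightarrow> (nat \<Rightarrow> 'x) set" where
  "weakly_null_seqs smul =
     {x. (\<forall>n. x n \<in> cball 0 1) \<and> limitin (weak_topology smul) x 0 sequentially}"

definition weak_star_null_seqs ::
    "('k::real_or_complex \<Rightarrow> 'x::banach \<Rightarrow> 'x) \<Rightarrow> (nat \<Rightarrow> 'x \<Rightarrow>\<^sub>L 'k) set" where
  "weak_star_null_seqs smul =
     {f. (\<forall>n. f n \<in> dual smul \<inter> cball 0 1) \<and>
         limitin (weak_star_topology smul) f 0 sequentially}"

section \<open>Subspaces isomorphic to $\ell_1$\<close>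

definition l1 :: "(nat \<Rightarrow> 'k::real_or_complex) set" where
  "l1 = {a. summable (\<lambda>n. norm (a n))}"

definition l1_norm :: "(nat \<Rightarrow> 'k::real_or_complex) \<Rightarrow> real" where
  "l1_norm a = (\<Sum>n. norm (a n))"

definition isomorphic_to_l1 ::
    "('k::real_or_complex \<Rightarrow> 'x::banach \<Rightarrow> 'x) \<Rightarrow> 'x set \<Rightarrow> bool" where
  "isomorphic_to_l1 smul Y \<longleftrightarrow>
     (\<exists>T :: (nat \<Rightarrow> 'k) \<Rightarrow> 'x.
        bij_betw T l1 Y \<and>
        (\<forall>a\<in>l1. \<forall>b\<in>l1. T (\<lambda>n. a n + b n) = T a + T b) \<and>
        (\<forall>c. \<forall>a\<in>l1. T (\<lambda>n. c * a n) = smul c (T a)) \<and>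
        (\<exists>C. \<forall>a\<in>l1. norm (T a) \<le> C * l1_norm a) \<and>
        (\<exists>C. \<forall>a\<in>l1. l1_norm a \<le> C * norm (T a)))"

definition contains_l1 :: "('k::real_or_complex \<Rightarrow> 'x::banach \<Rightarrow> 'x) \<Rightarrow> bool" where
  "contains_l1 smul \<longleftrightarrow>
     (\<exists>Y. module.subspace smul Y \<and> closed Y \<and> isomorphic_to_l1 smul Y)"

section \<open>Convex block subsequences and the quantities $K_1$, $K_2$, $G$, $R$\<close>

text \<open>
  Sequences are indexed from 0, so the block
  $\{x_i : k_{n-1}+1 \leq i \leq k_n\}$ of a sequence indexed from 1 becomes
  \<open>x ` {k n..<k (Suc n)}\<close>.
\<close>

definition cbs :: "(nat \<Rightarrow> 'v::real_vector) \<Rightarrow> (nat \<Rightarrow> 'v) set" where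
  "cbs x = {y. \<exists>k :: nat \<Rightarrow> nat. strict_mono k \<and> k 0 = 0 \<and>
                 (\<forall>n. y n \<in> convex hull (x ` {k n..<k (Suc n)}))}"

text \<open>
  Suprema, infima and upper limits are taken in the complete lattice \<^typ>\<open>ereal\<close>.
  In \<open>alpha\<close>, the empty set contributes \<open>-\<infinity>\<close>, which is harmless because
  \<open>{0}\<close> is also weakly compact.
\<close>

definition alpha ::
    "('k::real_or_complex \<Rightarrow> 'x::banach \<Rightarrow> 'x) \<Rightarrow> (nat \<Rightarrow> 'x \<Rightarrow>\<^sub>L 'k) \<Rightarrow> ereal" where
  "alpha smul f =
     (SUP K\<in>weakly_compact_sets smul.
        limsup (\<lambda>n. SUP x\<in>K. ereal (norm (blinfun_apply (f n) x))))"

definition beta ::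
    "('k::real_or_complex \<Rightarrow> 'x::banach \<Rightarrow> 'x) \<Rightarrow> (nat \<Rightarrow> 'x \<Rightarrow>\<^sub>L 'k) \<Rightarrow> ereal" where
  "beta smul f =
     (SUP x\<in>weakly_null_seqs smul. limsup (\<lambda>n. ereal (norm (blinfun_apply (f n) (x n)))))"

definition K1 :: "('k::real_or_complex \<Rightarrow> 'x::banach \<Rightarrow> 'x) \<Rightarrow> ereal" where
  "K1 smul = (SUP f\<in>weak_star_null_seqs smul. INF g\<in>cbs f. alpha smul g)"

definition K2 :: "('k::real_or_complex \<Rightarrow> 'x::banach \<Rightarrow> 'x) \<Rightarrow> ereal" where
  "K2 smul = (SUP f\<in>weak_star_null_seqs smul. INF g\<in>cbs f. beta smul g)"

definition G :: "('k::real_or_complex \<Rightarrow> 'x::banach \<Rightarrow> 'x) \<Rightarrow> ereal" where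
  "G smul =
     (SUP f\<in>weak_star_null_seqs smul. INF g\<in>cbs f. limsup (\<lambda>n. ereal (norm (g n))))"

definition ca :: "(nat \<Rightarrow> 'v::real_normed_vector) \<Rightarrow> ereal" where
  "ca x = (INF n. SUP (k, l)\<in>{n..} \<times> {n..}. ereal (norm (x k - x l)))"

text \<open>The Banach space in \<open>R\<close> is a closed subspace of a normed space type.\<close>

definition R :: "'v::real_normed_vector set \<Rightarrow> ereal" where
  "R Y = (SUP x\<in>{x :: nat \<Rightarrow> 'v. \<forall>n. x n \<in> Y \<inter> cball 0 1}. INF z\<in>cbs x. ca z)"

end

theory Submission
  imports Defs
begin

text \<open>
  The first two inequalities are elementary: \<open>K\<^sub>1 \<le> G\<close> holds term by term, and \<open>G \<le> R\<close> because the
  norm is weak* lower semicontinuous. For the third, a sequence in the dual ball has a convex block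
  subsequence converging weak* to some \<open>F\<close> (Bourgain; Hagler and Johnson), because \<open>X\<close> does not
  contain \<open>\<ell>\<^sub>1\<close>. Let \<open>p\<close> be a convex block subsequence of the halved differences to \<open>F\<close>. Then
  \<open>F + 2 p\<close> has \<open>ca\<close> at most \<open>4 limsup \<parallel>p\<^sub>n\<parallel>\<close>. Norming vectors \<open>x\<^sub>n\<close> of \<open>p\<^sub>n\<close> can be assumed weakly Cauchy
  by Rosenthal's theorem, and as \<open>p\<close> is weak* null, the weakly null vectors \<open>(x\<^sub>n - x\<^sub>m) / 2\<close> with \<open>n\<close>
  much larger than \<open>m\<close> give \<open>limsup \<parallel>p\<^sub>n\<parallel> \<le> 2 \<beta>(p)\<close>.
\<close>

subsection \<open>A Ramsey theorem for infinite sets\<close>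

text \<open>Even when X does not contain \<open>l1\<close>, its dual ball need not be weak*
  sequentially compact, so subsequences alone cannot supply the limit \<open>F\<close>. Convex
  blocks help because they allow an oscillation to be made minimal; a positive minimal oscillation
  can be split forever and builds a dyadic tree of functionals. Hence Rosenthal's theorem is needed
  twice: for the branches of this tree and for the norming vectors. It rests on a Ramsey theorem for
  infinite sets because independence asks for sign patterns of every finite length along one and the
  same subsequence. The constant 8 is a product of three factors 2. The differences to
  \<open>F\<close> have norm at most 2 and are halved to lie in the unit ball, as \<open>K2\<close>
  requires, and this halving has to be undone; \<open>ca\<close> compares two terms, which costs the
  triangle inequality; and \<open>beta\<close> tests vectors of the unit ball, so that differences
  of norming vectors are halved as well.\<close>

lemma infinite_Int_above:
  fixes s N :: "nat set"
  assumes "finite s" "infinite N"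
  shows "infinite (N \<inter> {n. \<forall>m\<in>s. m < n})"
proof
  assume "finite (N \<inter> {n. \<forall>m\<in>s. m < n})"
  moreover have "N \<subseteq> (N \<inter> {n. \<forall>m\<in>s. m < n}) \<union> {..Max s}"
    using Max_ge[OF assms(1)] by (fastforce simp: not_less intro: order_trans)
  ultimately show False
    using assms finite_subset by blast
qed

text \<open>A fusion argument. By \<open>tail\<close>, \<open>D s\<close> depends only on what lies
  above \<open>s\<close>, so \<open>s\<close> can be settled at the stage where its maximum is
  selected: each stage shrinks the set so that all subsets of an initial segment are settled, and
  \<open>N\<close> collects the least elements of the stages.\<close>

lemma diagonal_infinite_set:
  fixes D :: "nat set \<Rightarrow> nat set \<Rightarrow> bool"
  assumes ext: "\<And>s M. finite s \<Longrightarrow> infinite M \<Longrightarrow> \<exists>N\<subseteq>M. infinite N \<and> D s N"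
    and mono: "\<And>s M N. D s M \<Longrightarrow> N \<subseteq> M \<Longrightarrow> infinite N \<Longrightarrow> D s N"
    and tail: "\<And>s M. finite s \<Longrightarrow> infinite M \<Longrightarrow> D s (M \<inter> {n. \<forall>m\<in>s. m < n}) \<Longrightarrow> D s M"
    and M: "infinite M"
  obtains N where "N \<subseteq> M" "infinite N" "\<And>s. finite s \<Longrightarrow> s \<subseteq> N \<Longrightarrow> D s N"
proof -
  have ext_fin: "\<exists>N\<subseteq>M. infinite N \<and> (\<forall>s\<in>F. D s N)"
    if "finite F" "\<forall>s\<in>F. finite s" "infinite M" for F M
    using that
  proof (induction F)
    case (insert s F)
    then obtain N where N: "N \<subseteq> M" "infinite N" "\<forall>s\<in>F. D s N"
      by auto
    obtain N' where N': "N' \<subseteq> N" "infinite N'" "D s N'"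
      using ext[of s N] N insert.prems by auto
    have "\<forall>t\<in>insert s F. D t N'"
      using N(3) N'(3) mono[OF _ N'(1,2)] by simp
    then show ?case
      using N(1) N'(1,2) by (meson subset_trans)
  qed auto
  \<comment> \<open>The empty set has no maximum that would assign it to a stage, so it is settled
    beforehand.\<close>
  obtain M0 where M0: "M0 \<subseteq> M" "infinite M0" "D {} M0"
    using ext[of "{}" M] M by auto
  define least where "least A = (LEAST n. n \<in> A)" for A :: "nat set"
  have least_in: "least A \<in> A" if "infinite A" for A
    unfolding least_def using LeastI_ex[of "\<lambda>n. n \<in> A"] infinite_imp_nonempty[OF that] by auto
  define Q where "Q A B \<longleftrightarrow> B \<subseteq> A \<inter> {least A<..} \<and> (\<forall>s\<subseteq>{..least A}. D s B)" for A B
  define P where "P n A \<longleftrightarrow> infinite A \<and> (n = 0 \<longrightarrow> A = M0)" for n :: nat and A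
  have "\<exists>A. \<forall>n. P n (A n) \<and> Q (A n) (A (Suc n))"
  proof (rule dependent_nat_choice[of P "\<lambda>_. Q"])
    show "\<exists>A. P 0 A"
      using M0 by (auto simp: P_def)
  next
    fix A :: "nat set" and n :: nat
    assume "P n A"
    then have A: "infinite A"
      by (simp add: P_def)
    have "infinite (A \<inter> {least A<..})"
      using infinite_Int_above[of "{least A}" A] A by (simp add: greaterThan_def)
    moreover have "\<forall>s\<in>Pow {..least A}. finite s" "finite (Pow {..least A})"
      using finite_subset by auto
    ultimately obtain B where "B \<subseteq> A \<inter> {least A<..}" "infinite B" "\<forall>s\<in>Pow {..least A}. D s B"
      using ext_fin[of "Pow {..least A}" "A \<inter> {least A<..}"] by metis
    then show "\<exists>B. P (Suc n) B \<and> Q A B"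
      unfolding P_def Q_def by auto
  qed
  then obtain A where A: "\<And>n. P n (A n)" "\<And>n. Q (A n) (A (Suc n))"
    by metis
  have A: "infinite (A n)" "A 0 = M0" "A (Suc n) \<subseteq> A n \<inter> {least (A n)<..}"
      "s \<subseteq> {..least (A n)} \<Longrightarrow> D s (A (Suc n))" for n s
    using A(1)[of n] A(1)[of 0] A(2)[of n] unfolding P_def Q_def by auto
  define e where "e n = least (A n)" for n
  have eA: "e n \<in> A n" for n
    unfolding e_def by (rule least_in[OF A(1)])
  have decA: "A n \<subseteq> A m" if "m \<le> n" for m n
    using lift_Suc_antimono_le[of A, OF _ that] A(3) by (meson le_inf_iff)
  have e: "strict_mono e"
    unfolding strict_mono_Suc_iff
  proof
    fix n
    show "e n < e (Suc n)"
      using A(3)[of n] eA[of "Suc n"] by (auto simp: e_def)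
  qed
  define N where "N = range e"
  have "infinite N"
    unfolding N_def using e by (simp add: range_inj_infinite strict_mono_imp_inj_on)
  moreover have NM: "N \<subseteq> M0"
    unfolding N_def using eA decA[of 0] A(2) by auto
  moreover have "D s N" if s: "finite s" "s \<subseteq> N" for s
  proof (cases "s = {}")
    case True
    then show ?thesis
      using mono[OF M0(3)] NM \<open>infinite N\<close> by simp
  next
    case False
    with s have "Max s \<in> range e"
      using Max_in[of s] unfolding N_def by blast
    then obtain k where k: "Max s = e k"
      by auto
    have "s \<subseteq> {..e k}"
      unfolding k[symmetric] using s by auto
    then have "D s (A (Suc k))"
      using A(4) by (simp add: e_def)
    moreover have "N \<inter> {n. \<forall>m\<in>s. m < n} \<subseteq> A (Suc k)"
    proof
      fix n assume n: "n \<in> N \<inter> {n. \<forall>m\<in>s. m < n}"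
      then obtain j where j: "n = e j"
        by (auto simp: N_def)
      have "e k < e j"
        using n j Max_in[OF s(1) False] k by auto
      then have "Suc k \<le> j"
        using e strict_mono_less[OF e] by auto
      then show "n \<in> A (Suc k)"
        using eA[of j] decA[of "Suc k" j] j by auto
    qed
    moreover have "infinite (N \<inter> {n. \<forall>m\<in>s. m < n})"
      using s(1) \<open>infinite N\<close> by (rule infinite_Int_above)
    ultimately show ?thesis
      using tail[OF s(1) \<open>infinite N\<close>] mono[of s "A (Suc k)" "N \<inter> {n. \<forall>m\<in>s. m < n}"] by simp
  qed
  ultimately show ?thesis
    using that[of N] M0(1) by auto
qed

text \<open>
  The Nash-Williams partition theorem for open families, by the accept/reject argument.
\<close>

lemma open_ramsey:
  fixes T :: "nat set set" and M0 :: "nat set"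
  assumes "infinite M0"
  obtains M where "M \<subseteq> M0" "infinite M"
    "(\<forall>N\<subseteq>M. infinite N \<longrightarrow> (\<exists>k. N \<inter> {..<k} \<in> T)) \<or> (\<forall>s\<subseteq>M. finite s \<longrightarrow> s \<notin> T)"
proof -
  \<comment> \<open>Acceptance: every infinite continuation of \<open>s\<close> inside
    \<open>M\<close> has an initial segment in \<open>T\<close>. Rejection is stronger than failing
    to accept, since it must persist in all infinite subsets; this makes both notions hereditary and
    fit for fusion.\<close>
  define acc where "acc s M \<longleftrightarrow> (\<forall>N\<subseteq>M. infinite N \<longrightarrow> (\<forall>n\<in>N. \<forall>m\<in>s. m < n) \<longrightarrow>
    (\<exists>k. (s \<union> N) \<inter> {..<k} \<in> T))" for s M
  define rej where "rej s M \<longleftrightarrow> (\<forall>N\<subseteq>M. infinite N \<longrightarrow> \<not> acc s N)" for s M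
  have accD: "\<exists>k. (s \<union> N) \<inter> {..<k} \<in> T"
    if "acc s M" "N \<subseteq> M" "infinite N" "\<forall>n\<in>N. \<forall>m\<in>s. m < n" for s M N
    using that unfolding acc_def by simp
  have rejD: "\<not> acc s N" if "rej s M" "N \<subseteq> M" "infinite N" for s M N
    using that unfolding rej_def by simp
  have acc_mono: "acc s N" if "acc s M" "N \<subseteq> M" for s M N
    unfolding acc_def using accD[OF that(1)] that(2) by (metis subset_trans)
  have rej_mono: "rej s N" if "rej s M" "N \<subseteq> M" for s M N
    unfolding rej_def using rejD[OF that(1)] that(2) by (metis subset_trans)
  have acc_tail: "acc s M" if "acc s (M \<inter> {n. \<forall>m\<in>s. m < n})" for s M
    unfolding acc_def
  proof (intro allI impI)
    fix N assume "N \<subseteq> M" "infinite N" "\<forall>n\<in>N. \<forall>m\<in>s. m < n"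
    moreover from this have "N \<subseteq> M \<inter> {n. \<forall>m\<in>s. m < n}"
      by auto
    ultimately show "\<exists>k. (s \<union> N) \<inter> {..<k} \<in> T"
      using accD[OF that] by simp
  qed
  have rej_tail: "rej s M" if "finite s" "rej s (M \<inter> {n. \<forall>m\<in>s. m < n})" for s M
    unfolding rej_def
  proof (intro allI impI notI)
    fix N assume N: "N \<subseteq> M" "infinite N" "acc s N"
    have "acc s (N \<inter> {n. \<forall>m\<in>s. m < n})"
      using N(3) by (rule acc_mono) simp
    then show False
      using rejD[OF that(2) _ infinite_Int_above[OF that(1) N(2)]] N(1) by blast
  qed
  obtain M1 where M1: "M1 \<subseteq> M0" "infinite M1"
      "\<And>s. finite s \<Longrightarrow> s \<subseteq> M1 \<Longrightarrow> acc s M1 \<or> rej s M1"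
  proof (rule diagonal_infinite_set[of "\<lambda>s M. acc s M \<or> rej s M" M0])
    fix s M :: "nat set" assume "finite s" "infinite M"
    then show "\<exists>N\<subseteq>M. infinite N \<and> (acc s N \<or> rej s N)"
      unfolding rej_def by blast
  next
    show "acc s N \<or> rej s N" if "acc s M \<or> rej s M" "N \<subseteq> M" for s M N
      using that acc_mono rej_mono by metis
    show "acc s M \<or> rej s M"
      if "finite s" "acc s (M \<inter> {n. \<forall>m\<in>s. m < n}) \<or> rej s (M \<inter> {n. \<forall>m\<in>s. m < n})" for s M
      using that acc_tail rej_tail by metis
  qed (use assms in auto)
  show ?thesis
  proof (cases "acc {} M1")
    case True
    then have "\<forall>N\<subseteq>M1. infinite N \<longrightarrow> (\<exists>k. N \<inter> {..<k} \<in> T)"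
      by (simp add: acc_def)
    with M1 that[of M1] show ?thesis by simp
  next
    case False
    then have rej0: "rej {} M1"
      using M1(3)[of "{}"] by simp
    \<comment> \<open>A second fusion: rejection is to pass from \<open>s\<close> to each one-point
      extension within the set, so that it spreads from the empty set to all finite subsets by
      induction.\<close>
    define D where "D s N \<longleftrightarrow> (s \<subseteq> M1 \<and> rej s M1 \<longrightarrow>
      (\<forall>n\<in>N \<inter> M1. (\<forall>m\<in>s. m < n) \<longrightarrow> rej (insert n s) M1))" for s N
    obtain M2 where M2: "M2 \<subseteq> M1" "infinite M2" "\<And>s. finite s \<Longrightarrow> s \<subseteq> M2 \<Longrightarrow> D s M2"
    proof (rule diagonal_infinite_set[of D M1])
      fix s M :: "nat set" assume s: "finite s" and M: "infinite M"
      show "\<exists>N\<subseteq>M. infinite N \<and> D s N"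
      proof (cases "s \<subseteq> M1 \<and> rej s M1")
        case True
        define E where "E = {n \<in> M1. (\<forall>m\<in>s. m < n) \<and> \<not> rej (insert n s) M1}"
        \<comment> \<open>\<open>E\<close> collects the extensions that spoil rejection. As
          \<open>M1\<close> decides everything, these are accepted, and a continuation of
          \<open>s\<close> in \<open>E\<close> is a continuation of \<open>insert n s\<close> for
          its least element \<open>n\<close>. An infinite \<open>E\<close> would thus contradict the
          rejection of \<open>s\<close>, and a finite one can be removed.\<close>
        have "acc s E"
          unfolding acc_def
        proof (intro allI impI)
          fix N assume N: "N \<subseteq> E" "infinite N" "\<forall>n\<in>N. \<forall>m\<in>s. m < n"
          define n where "n = (LEAST n. n \<in> N)"
          have n: "n \<in> N"
            unfolding n_def using LeastI_ex[of "\<lambda>n. n \<in> N"] infinite_imp_nonempty[OF N(2)] by auto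
          have le: "n \<le> k" if "k \<in> N" for k
            unfolding n_def using that by (rule Least_le)
          have "acc (insert n s) M1"
            using M1(3)[of "insert n s"] n N(1) True s by (auto simp: E_def)
          moreover have "N - {n} \<subseteq> M1" "infinite (N - {n})"
            using N by (auto simp: E_def)
          moreover have "\<forall>k\<in>N - {n}. \<forall>m\<in>insert n s. m < k"
            using N(3) le by fastforce
          ultimately obtain k where "(insert n s \<union> (N - {n})) \<inter> {..<k} \<in> T"
            using accD by metis
          moreover have "insert n s \<union> (N - {n}) = s \<union> N"
            using n by auto
          ultimately show "\<exists>k. (s \<union> N) \<inter> {..<k} \<in> T"
            by auto
        qed
        then have "finite E"
          using True rejD[of s M1 E] by (auto simp: E_def)
        then have "infinite (M - E)"
          using M by auto
        moreover have "D s (M - E)"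
          unfolding D_def E_def by auto
        ultimately show ?thesis
          by blast
      qed (use M in \<open>auto simp: D_def\<close>)
    next
      fix s M :: "nat set" assume "D s (M \<inter> {n. \<forall>m\<in>s. m < n})"
      then show "D s M"
        unfolding D_def by blast
    qed (use M1 in \<open>auto simp: D_def\<close>)
    have rej_all: "finite s \<Longrightarrow> s \<subseteq> M2 \<Longrightarrow> rej s M1" for s
    proof (induction s rule: finite_linorder_max_induct)
      case empty
      show ?case by (fact rej0)
    next
      case (insert n s)
      then have "D s M2" "s \<subseteq> M1" "rej s M1" "n \<in> M2 \<inter> M1" "\<forall>m\<in>s. m < n"
        using M2 by auto
      then show ?case
        unfolding D_def by blast
    qed
    have "s \<notin> T" if s: "finite s" "s \<subseteq> M2" for s
    proof
      assume "s \<in> T"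
      \<comment> \<open>A member of \<open>T\<close> is an initial segment of each of its own
        continuations, hence cannot be rejected.\<close>
      have "acc s M1"
        unfolding acc_def
      proof (intro allI impI)
        fix N assume N: "infinite N" "\<forall>n\<in>N. \<forall>m\<in>s. m < n"
        show "\<exists>k. (s \<union> N) \<inter> {..<k} \<in> T"
        proof (cases "s = {}")
          case True
          then show ?thesis
            using \<open>s \<in> T\<close> by (auto intro: exI[of _ 0])
        next
          case False
          have "(s \<union> N) \<inter> {..<Suc (Max s)} = s"
            using N(2) s(1) Max_in[OF s(1) False] by (auto simp: less_Suc_eq_le)
              (metis leD)
          then show ?thesis
            using \<open>s \<in> T\<close> by metis
        qed
      qed
      then show False
        using rejD[OF rej_all[OF s] subset_refl M1(2)] by simp
    qed
    then show ?thesis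
      using that[of M2] M1(1) M2(1,2) by blast
  qed
qed

subsection \<open>Rosenthal's theorem\<close>

text \<open>The closed isometric image in the complex numbers is the source of compactness and
  completeness for the abstract scalar class.\<close>

lemma scalar_embedding:
  obtains \<phi> :: "'k::real_or_complex \<Rightarrow> complex"
  where "linear \<phi>" "\<And>x y. \<phi> (x * y) = \<phi> x * \<phi> y" "\<And>x. norm (\<phi> x) = norm x"
    "closed (range \<phi>)"
proof -
  obtain \<phi> :: "'k \<Rightarrow> complex" where \<phi>: "range \<phi> = \<real> \<or> range \<phi> = UNIV"
      "\<forall>x y. \<phi> (x + y) = \<phi> x + \<phi> y" "\<forall>x y. \<phi> (x * y) = \<phi> x * \<phi> y"
      "\<forall>r x. \<phi> (r *\<^sub>R x) = r *\<^sub>R \<phi> x" "\<forall>x. norm (\<phi> x) = norm x"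
    using real_or_complex by metis
  have "closed (range \<phi>)"
    using \<phi>(1) closed_complex_Reals by auto
  then show ?thesis
    using that[of \<phi>] \<phi> by (simp add: linear_iff)
qed

lemma scalar_bounded_convergent_subseq:
  fixes z :: "nat \<Rightarrow> 'k::real_or_complex"
  assumes "\<And>n. norm (z n) \<le> C"
  obtains l r where "strict_mono (r :: nat \<Rightarrow> nat)" "(z \<circ> r) \<longlonglongrightarrow> l"
proof -
  obtain \<phi> :: "'k \<Rightarrow> complex" where \<phi>: "linear \<phi>" "\<And>x. norm (\<phi> x) = norm x" "closed (range \<phi>)"
    using scalar_embedding by metis
  have "bounded (range (\<lambda>n. \<phi> (z n)))"
    using assms \<phi>(2) by (auto intro!: boundedI)
  then obtain w and r :: "nat \<Rightarrow> nat" where r: "strict_mono r" "((\<lambda>n. \<phi> (z n)) \<circ> r) \<longlonglongrightarrow> w"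
    using bounded_imp_convergent_subsequence by metis
  have "w \<in> range \<phi>"
    using closed_sequentially[OF \<phi>(3) _ r(2)] by auto
  then obtain l where l: "w = \<phi> l"
    by auto
  have "(\<lambda>n. \<phi> (z (r n)) - \<phi> l) \<longlonglongrightarrow> 0"
    using r(2) by (simp add: l o_def LIM_zero)
  moreover have "norm (\<phi> (z (r n)) - \<phi> l) = norm (z (r n) - l)" for n
    by (metis \<phi>(2) linear_diff[OF \<phi>(1)])
  ultimately have "(\<lambda>n. norm (z (r n) - l)) \<longlonglongrightarrow> 0"
    using tendsto_norm_zero by fastforce
  then have "(z \<circ> r) \<longlonglongrightarrow> l"
    unfolding o_def by (rule LIM_zero_cancel[OF tendsto_norm_zero_cancel])
  with r(1) show ?thesis
    by (rule that)
qed

lemma scalar_Cauchy_convergent: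
  fixes z :: "nat \<Rightarrow> 'k::real_or_complex"
  assumes "Cauchy z"
  shows "convergent z"
proof -
  obtain C where "\<And>n. norm (z n) \<le> C"
    using cauchy_imp_bounded[OF assms] by (auto simp: bounded_iff)
  then obtain l r where "strict_mono (r :: nat \<Rightarrow> nat)" "(z \<circ> r) \<longlonglongrightarrow> l"
    by (rule scalar_bounded_convergent_subseq)
  then show ?thesis
    using Cauchy_converges_subseq[OF assms] by (auto simp: convergent_def)
qed

lemma scalar_two_limits:
  fixes z :: "nat \<Rightarrow> 'k::real_or_complex"
  assumes bd: "\<And>n. norm (z n) \<le> C" and "\<not> convergent z"
  obtains r s l l' where "strict_mono (r :: nat \<Rightarrow> nat)" "strict_mono (s :: nat \<Rightarrow> nat)"
    "(z \<circ> r) \<longlonglongrightarrow> l" "(z \<circ> s) \<longlonglongrightarrow> l'" "l \<noteq> l'"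
proof -
  obtain l r where r: "strict_mono (r :: nat \<Rightarrow> nat)" "(z \<circ> r) \<longlonglongrightarrow> l"
    using scalar_bounded_convergent_subseq[OF bd] .
  have "\<not> z \<longlonglongrightarrow> l"
    using assms(2) by (auto simp: convergent_def)
  then obtain e where e: "e > 0" "\<forall>N. \<exists>n\<ge>N. e \<le> dist (z n) l"
    unfolding lim_sequentially by (metis not_le)
  define S where "S = {n. e \<le> dist (z n) l}"
  have S: "infinite S"
    using e(2) unfolding infinite_nat_iff_unbounded_le S_def by auto
  obtain l' s where s: "strict_mono (s :: nat \<Rightarrow> nat)" "((z \<circ> enumerate S) \<circ> s) \<longlonglongrightarrow> l'"
    using scalar_bounded_convergent_subseq[of "z \<circ> enumerate S" C] bd by (metis comp_apply)
  have "(\<lambda>n. dist ((z \<circ> enumerate S \<circ> s) n) l) \<longlonglongrightarrow> dist l' l"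
    by (intro tendsto_intros s)
  moreover have "e \<le> dist ((z \<circ> enumerate S \<circ> s) n) l" for n
    using enumerate_in_set[OF S] by (simp add: S_def)
  ultimately have "e \<le> dist l' l"
    by (intro LIMSEQ_le_const[of _ _ e]) auto
  then have "l \<noteq> l'"
    using e(1) by auto
  moreover have "strict_mono (enumerate S \<circ> s)"
    using S s(1) by (simp add: strict_mono_o strict_mono_enumerate)
  ultimately show ?thesis
    using that[OF r(1) _ r(2)] s(2) by (simp add: o_assoc)
qed

text \<open>The Ramsey theorem is applied to the finite sets along which no \<open>w\<close>
  alternates between \<open>A\<close> and \<open>B\<close>. A \<open>w\<close> that is infinitely
  often in both excludes the first alternative, because it alternates along some infinite set. So
  every finite subset of \<open>M\<close> admits an alternating \<open>w\<close>, and skipping or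
  inserting elements turns alternation into an arbitrary pattern.\<close>

lemma independent_subsequence:
  fixes A B :: "nat \<Rightarrow> 'w set"
  assumes "infinite M0"
    and AB: "\<And>N. N \<subseteq> M0 \<Longrightarrow> infinite N \<Longrightarrow> \<exists>w. infinite {n\<in>N. w \<in> A n} \<and> infinite {n\<in>N. w \<in> B n}"
  obtains p where "strict_mono (p :: nat \<Rightarrow> nat)"
    "\<forall>k P. \<exists>w. \<forall>i<k. (i \<in> P \<longrightarrow> w \<in> A (p i)) \<and> (i \<notin> P \<longrightarrow> w \<in> B (p i))"
proof -
  define good where "good w s \<longleftrightarrow>
    (\<forall>m\<in>s. (even (card {j\<in>s. j < m}) \<longrightarrow> w \<in> A m) \<and> (odd (card {j\<in>s. j < m}) \<longrightarrow> w \<in> B m))"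
    for w and s :: "nat set"
  define T where "T = {s. \<forall>w. \<not> good w s}"
  obtain M where M: "M \<subseteq> M0" "infinite M"
      "(\<forall>N\<subseteq>M. infinite N \<longrightarrow> (\<exists>k. N \<inter> {..<k} \<in> T)) \<or> (\<forall>s\<subseteq>M. finite s \<longrightarrow> s \<notin> T)"
    using open_ramsey[OF assms(1)] by metis
  have "\<not> (\<forall>N\<subseteq>M. infinite N \<longrightarrow> (\<exists>k. N \<inter> {..<k} \<in> T))"
  proof
    assume all: "\<forall>N\<subseteq>M. infinite N \<longrightarrow> (\<exists>k. N \<inter> {..<k} \<in> T)"
    obtain w where w: "infinite {n\<in>M. w \<in> A n}" "infinite {n\<in>M. w \<in> B n}"
      using AB[OF M(1,2)] by auto
    define P where "P n m \<longleftrightarrow> m \<in> M \<and> (even n \<longrightarrow> w \<in> A m) \<and> (odd n \<longrightarrow> w \<in> B m)" for n m :: nat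
    have ex: "\<exists>m>k. P n m" for n k
    proof (cases "even n")
      case True
      then show ?thesis
        using w(1) unfolding infinite_nat_iff_unbounded P_def by auto
    next
      case False
      then show ?thesis
        using w(2) unfolding infinite_nat_iff_unbounded P_def by auto
    qed
    have "\<exists>e. \<forall>n. P n (e n) \<and> e n < e (Suc n)"
    proof (rule dependent_nat_choice[of P "\<lambda>_. (<)"])
      show "\<exists>m. P 0 m"
        using ex by blast
      show "\<exists>y. P (Suc n) y \<and> x < y" for x n
        using ex by blast
    qed
    then obtain e where e: "\<And>n. P n (e n)" "\<And>n. e n < e (Suc n)"
      by metis
    have mono: "strict_mono e"
      using e(2) by (simp add: strict_mono_Suc_iff)
    have "infinite (range e)"
      using mono by (simp add: range_inj_infinite strict_mono_imp_inj_on)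
    moreover have "range e \<subseteq> M"
      using e(1) by (auto simp: P_def)
    ultimately obtain k where k: "range e \<inter> {..<k} \<in> T"
      using all by metis
    have "good w (range e \<inter> {..<k})"
      unfolding good_def
    proof
      fix m assume m: "m \<in> range e \<inter> {..<k}"
      then obtain i where i: "m = e i" "e i < k"
        by auto
      have "{j \<in> range e \<inter> {..<k}. j < m} = e ` {..<i}"
        using i strict_mono_less[OF mono] by (auto intro: less_trans)
      then have "card {j \<in> range e \<inter> {..<k}. j < m} = i"
        using mono by (simp add: card_image strict_mono_imp_inj_on inj_on_subset)
      then show "(even (card {j \<in> range e \<inter> {..<k}. j < m}) \<longrightarrow> w \<in> A m) \<and>
          (odd (card {j \<in> range e \<inter> {..<k}. j < m}) \<longrightarrow> w \<in> B m)"
        using e(1)[of i] i by (simp add: P_def)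
    qed
    with k show False
      by (simp add: T_def)
  qed
  then have fin: "\<exists>w. good w s" if "s \<subseteq> M" "finite s" for s
    using M(3) that unfolding T_def by blast
  define m where "m = enumerate M"
  have m: "strict_mono m" "\<And>i. m i \<in> M"
    using M(2) by (auto simp: m_def strict_mono_enumerate enumerate_in_set)
  \<comment> \<open>the elements of even index are fillers that adjust the parity of the position of \<open>p i\<close>\<close>
  define p where "p i = m (2 * i + 1)" for i
  show ?thesis
  proof (rule that[of p]; (intro allI)?)
    show "strict_mono p"
      using m(1) by (auto simp: p_def strict_mono_def)
    fix k :: nat and P :: "nat set"
    \<comment> \<open>The filler \<open>m (2 * i)\<close> is inserted exactly when the number of
      elements chosen so far has the wrong parity for the demand that \<open>P\<close> makes at
      \<open>i\<close>.\<close>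
    define S where "S = rec_nat {} (\<lambda>i s. s \<union> (if even (card s) \<longleftrightarrow> i \<in> P then {p i} else {m (2 * i), p i}))"
    have S0: "S 0 = {}"
      and SSuc: "S (Suc i) = S i \<union> (if even (card (S i)) \<longleftrightarrow> i \<in> P then {p i} else {m (2 * i), p i})" for i
      by (simp_all add: S_def)
    have Sfin: "finite (S i)" and SM: "S i \<subseteq> M" for i
      by (induction i) (auto simp: S0 SSuc m(2) p_def)
    \<comment> \<open>Later stages add nothing below \<open>m (2 * i)\<close>, so the position of
      \<open>p i\<close> in \<open>S k\<close> can be computed in \<open>S (Suc i)\<close>.\<close>
    have Scut: "S j \<inter> {..<m (2 * i)} = S i" if "i \<le> j" for i j
      using that
    proof (induction j rule: dec_induct)
      case base
      show ?case
      proof (cases i)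
        case (Suc i')
        have "S i' \<subseteq> {..<m (2 * i')}" for i'
        proof (induction i')
          case (Suc i')
          have "m (2 * i') < m (2 * Suc i')" "p i' < m (2 * Suc i')"
            using m(1) by (auto simp: p_def strict_mono_def)
          with Suc show ?case
            by (auto simp: SSuc)
        qed (simp add: S0)
        then show ?thesis
          by blast
      qed (simp add: S0)
    next
      case (step j)
      have "m (2 * i) \<le> m (2 * j)" "m (2 * i) \<le> p j"
        using step(1) m(1) by (auto simp: p_def strict_mono_less_eq)
      with step show ?case
        by (auto simp: SSuc)
    qed
    obtain w where w: "good w (S k)"
      using fin[OF SM Sfin] by blast
    have "(i \<in> P \<longrightarrow> w \<in> A (p i)) \<and> (i \<notin> P \<longrightarrow> w \<in> B (p i))" if "i < k" for i
    proof -
      have lt: "m (2 * i) < p i" "p i < m (2 * Suc i)"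
        using m(1) by (auto simp: p_def strict_mono_def)
      have cut: "S i \<subseteq> {..<m (2 * i)}"
        using Scut[of i i] by blast
      have "S (Suc i) \<subseteq> S k"
        using Scut[of "Suc i" k] that by auto
      then have pin: "p i \<in> S k"
        by (auto simp: SSuc split: if_splits)
      have "{j \<in> S k. j < p i} = (S k \<inter> {..<m (2 * Suc i)}) \<inter> {..<p i}"
        using lt(2) by (auto intro: less_trans)
      also have "\<dots> = S (Suc i) \<inter> {..<p i}"
        using Scut[of "Suc i" k] that by simp
      also have "\<dots> = S i \<union> (if even (card (S i)) \<longleftrightarrow> i \<in> P then {} else {m (2 * i)})"
        using cut lt by (auto simp: SSuc)
      finally have "even (card {j \<in> S k. j < p i}) \<longleftrightarrow> i \<in> P"
        using cut Sfin by (auto simp: card_insert_if)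
      with w pin show ?thesis
        by (auto simp: good_def)
    qed
    then show "\<exists>w. \<forall>i<k. (i \<in> P \<longrightarrow> w \<in> A (p i)) \<and> (i \<notin> P \<longrightarrow> w \<in> B (p i))"
      by blast
  qed
qed

section \<open>The space \<open>l1\<close> and a criterion for embedding it\<close>

lemma norm_le_l1_norm: "norm (a i) \<le> l1_norm a" if "a \<in> l1"
  using sum_le_suminf[of "\<lambda>n. norm (a n)" "{i}"] that by (simp add: l1_def l1_norm_def)

lemma l1_add: "(\<lambda>n. a n + b n) \<in> l1" if "a \<in> l1" "b \<in> l1"
  using that summable_comparison_test'[of "\<lambda>n. norm (a n) + norm (b n)" 0 "\<lambda>n. norm (a n + b n)"]
  by (simp add: l1_def summable_add norm_triangle_ineq)

lemma l1_cmult: "(\<lambda>n. c * a n) \<in> l1" if "a \<in> l1"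
  using that unfolding l1_def by (auto simp: norm_mult intro: summable_mult)

lemma l1_diff: "(\<lambda>n. a n - b n) \<in> l1" if "a \<in> l1" "b \<in> l1"
  using l1_add[OF that(1) l1_cmult[OF that(2), of "-1"]] by simp

text \<open>Needed for closed range of embeddings. \<open>l1\<close> is a mere set of functions, so
  completeness is derived by hand: coordinates converge, and bounds on finite partial sums pass to
  the limit.\<close>

lemma l1_complete:
  fixes a :: "nat \<Rightarrow> nat \<Rightarrow> 'k::real_or_complex"
  assumes a: "\<And>n. a n \<in> l1"
    and Cau: "\<And>e. e > 0 \<Longrightarrow> \<exists>N. \<forall>m\<ge>N. \<forall>n\<ge>N. l1_norm (\<lambda>i. a m i - a n i) \<le> e"
  obtains b where "b \<in> l1" "(\<lambda>n. l1_norm (\<lambda>i. a n i - b i)) \<longlonglongrightarrow> 0"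
proof -
  have "convergent (\<lambda>n. a n i)" for i
  proof (intro scalar_Cauchy_convergent metric_CauchyI)
    fix e :: real assume "e > 0"
    then obtain N where N: "\<forall>m\<ge>N. \<forall>n\<ge>N. l1_norm (\<lambda>i. a m i - a n i) \<le> e / 2"
      using Cau[of "e / 2"] by auto
    have "dist (a m i) (a n i) < e" if "m \<ge> N" "n \<ge> N" for m n
      using norm_le_l1_norm[OF l1_diff[OF a a], of m i n] N that \<open>e > 0\<close>
      by (fastforce simp: dist_norm)
    then show "\<exists>N. \<forall>m\<ge>N. \<forall>n\<ge>N. dist (a m i) (a n i) < e"
      by blast
  qed
  then obtain b where b: "\<And>i. (\<lambda>n. a n i) \<longlonglongrightarrow> b i"
    unfolding convergent_def by metis
  have near: "(\<lambda>i. a m i - b i) \<in> l1 \<and> l1_norm (\<lambda>i. a m i - b i) \<le> e"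
    if N: "\<forall>m\<ge>N. \<forall>n\<ge>N. l1_norm (\<lambda>i. a m i - a n i) \<le> e" and "m \<ge> N" for m N e
  proof -
    have part: "(\<Sum>i<k. norm (a m i - b i)) \<le> e" for k
    proof (rule LIMSEQ_le_const2)
      show "(\<lambda>n. \<Sum>i<k. norm (a m i - a n i)) \<longlonglongrightarrow> (\<Sum>i<k. norm (a m i - b i))"
        by (intro tendsto_intros b)
      have "(\<Sum>i<k. norm (a m i - a n i)) \<le> e" if "n \<ge> N" for n
      proof -
        have "(\<Sum>i<k. norm (a m i - a n i)) \<le> l1_norm (\<lambda>i. a m i - a n i)"
          unfolding l1_norm_def using l1_diff[OF a a, of m n]
          by (intro sum_le_suminf) (auto simp: l1_def)
        with N that \<open>m \<ge> N\<close> show ?thesis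
          by fastforce
      qed
      then show "\<exists>N. \<forall>n\<ge>N. (\<Sum>i<k. norm (a m i - a n i)) \<le> e"
        by blast
    qed
    have "summable (\<lambda>i. norm (a m i - b i))"
      by (rule summableI_nonneg_bounded[OF _ part]) auto
    then show ?thesis
      using suminf_le_const[OF _ part] by (auto simp: l1_def l1_norm_def)
  qed
  obtain N where N: "\<forall>m\<ge>N. \<forall>n\<ge>N. l1_norm (\<lambda>i. a m i - a n i) \<le> 1"
    using Cau[of 1] by auto
  have "b \<in> l1"
    using l1_diff[OF a[of N] near[OF N order_refl, THEN conjunct1]] by simp
  moreover have "(\<lambda>n. l1_norm (\<lambda>i. a n i - b i)) \<longlonglongrightarrow> 0"
  proof (rule LIMSEQ_I)
    fix e :: real assume "e > 0"
    then obtain N where N: "\<forall>m\<ge>N. \<forall>n\<ge>N. l1_norm (\<lambda>i. a m i - a n i) \<le> e / 2"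
      using Cau[of "e / 2"] by auto
    have "norm (l1_norm (\<lambda>i. a m i - b i) - 0) < e" if "m \<ge> N" for m
    proof -
      have "l1_norm (\<lambda>i. a m i - b i) \<ge> 0"
        using near[OF N that] unfolding l1_norm_def l1_def by (auto intro: suminf_nonneg)
      with near[OF N that] \<open>e > 0\<close> show ?thesis
        by auto
    qed
    then show "\<exists>N. \<forall>m\<ge>N. norm (l1_norm (\<lambda>i. a m i - b i) - 0) < e"
      by blast
  qed
  ultimately show ?thesis
    by (rule that)
qed

lemma (in banach_space_over) bounded_linear_smul: "bounded_linear (smul c)"
proof (rule bounded_linear_intro[where K = "norm c"])
  show "smul c (r *\<^sub>R x) = r *\<^sub>R smul c x" for r x
    by (simp add: scale_left_commute flip: scale_of_real)
qed (simp_all add: scale_right_distrib norm_scale mult.commute)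

text \<open>The lower estimate extends from finite sums to the series operator \<open>T\<close>. It
  makes \<open>T\<close> injective, and it turns Cauchy sequences in the range into Cauchy sequences
  of coefficients, so that the range is closed.\<close>

lemma (in banach_space_over) contains_l1I:
  fixes y :: "nat \<Rightarrow> 'x"
  assumes y: "\<And>n. norm (y n) \<le> 1" and "c > 0"
    and lower: "\<And>k a. c * (\<Sum>i<k. norm (a i)) \<le> norm (\<Sum>i<k. smul (a i) (y i))"
  shows "contains_l1 smul"
proof -
  define T where "T a = (\<Sum>n. smul (a n) (y n))" for a
  have le: "norm (smul (a n) (y n)) \<le> norm (a n)" for a n
    using y[of n] mult_left_le[of "norm (y n)" "norm (a n)"] by (simp add: norm_scale)
  have sn: "summable (\<lambda>n. norm (smul (a n) (y n)))" if "a \<in> l1" for a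
    using that le summable_comparison_test'[of "\<lambda>n. norm (a n)" 0 "\<lambda>n. norm (smul (a n) (y n))"]
    by (simp add: l1_def)
  have s: "summable (\<lambda>n. smul (a n) (y n))" if "a \<in> l1" for a
    using summable_norm_cancel[OF sn[OF that]] .
  have Tadd: "T (\<lambda>n. a n + b n) = T a + T b" if "a \<in> l1" "b \<in> l1" for a b
    unfolding T_def by (subst suminf_add) (simp_all add: s that scale_left_distrib)
  have Tscale: "T (\<lambda>n. d * a n) = smul d (T a)" if "a \<in> l1" for a d
    unfolding T_def by (subst bounded_linear.suminf[OF bounded_linear_smul s[OF that]]) simp
  have upper: "norm (T a) \<le> 1 * l1_norm a" if "a \<in> l1" for a
  proof -
    have "norm (T a) \<le> (\<Sum>n. norm (smul (a n) (y n)))"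
      unfolding T_def by (rule summable_norm[OF sn[OF that]])
    also have "\<dots> \<le> l1_norm a"
      unfolding l1_norm_def using that by (intro suminf_le le sn) (auto simp: l1_def)
    finally show ?thesis
      by simp
  qed
  have low: "l1_norm a \<le> (1 / c) * norm (T a)" if "a \<in> l1" for a
  proof -
    have "c * l1_norm a \<le> norm (T a)"
    proof (rule LIMSEQ_le)
      show "(\<lambda>k. c * (\<Sum>i<k. norm (a i))) \<longlonglongrightarrow> c * l1_norm a"
        unfolding l1_norm_def using that by (intro tendsto_intros summable_LIMSEQ) (simp add: l1_def)
      show "(\<lambda>k. norm (\<Sum>i<k. smul (a i) (y i))) \<longlonglongrightarrow> norm (T a)"
        unfolding T_def using s[OF that] by (intro tendsto_intros summable_LIMSEQ)
    qed (use lower in auto)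
    then show ?thesis
      using \<open>c > 0\<close> by (simp add: field_simps)
  qed
  have Tdiff: "T (\<lambda>n. a n - b n) = T a - T b" if "a \<in> l1" "b \<in> l1" for a b
    using Tadd[OF that(1) l1_cmult[OF that(2), of "-1"]] Tscale[OF that(2), of "-1"] by simp
  have "inj_on T l1"
  proof (rule inj_onI)
    fix a b :: "nat \<Rightarrow> 'k" assume ab: "a \<in> l1" "b \<in> l1" "T a = T b"
    then have "l1_norm (\<lambda>n. a n - b n) \<le> 0"
      using low[OF l1_diff[OF ab(1,2)]] Tdiff by simp
    then have "norm (a n - b n) \<le> 0" for n
      using norm_le_l1_norm[OF l1_diff[OF ab(1,2)], of n] by linarith
    then show "a = b"
      by (simp add: fun_eq_iff)
  qed
  then have "bij_betw T l1 (T ` l1)"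
    by (rule inj_on_imp_bij_betw)
  then have "isomorphic_to_l1 smul (T ` l1)"
    unfolding isomorphic_to_l1_def
    by (intro exI[of _ T] exI[of _ 1] exI[of _ "1 / c"] conjI ballI allI Tadd Tscale upper low)
  moreover have "subspace (T ` l1)"
  proof (rule subspaceI)
    have "T (\<lambda>_. 0) = 0" "(\<lambda>_. 0) \<in> l1"
      by (simp_all add: T_def l1_def)
    then show "0 \<in> T ` l1"
      by (metis imageI)
    show "u + v \<in> T ` l1" if "u \<in> T ` l1" "v \<in> T ` l1" for u v
      using that by (auto simp flip: Tadd intro!: imageI l1_add)
    show "smul d u \<in> T ` l1" if "u \<in> T ` l1" for d u
      using that by (auto simp flip: Tscale intro!: imageI l1_cmult)
  qed
  moreover have "closed (T ` l1)"
    unfolding closed_sequential_limits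
  proof (intro allI impI)
    fix u l assume u: "(\<forall>n. u n \<in> T ` l1) \<and> u \<longlonglongrightarrow> l"
    then have l: "u \<longlonglongrightarrow> l"
      by simp
    have "\<forall>n. \<exists>b. b \<in> l1 \<and> u n = T b"
      using u by blast
    then obtain a where a: "\<And>n. a n \<in> l1" "\<And>n. u n = T (a n)"
      by metis
    obtain b where b: "b \<in> l1" "(\<lambda>n. l1_norm (\<lambda>i. a n i - b i)) \<longlonglongrightarrow> 0"
    proof (rule l1_complete[OF a(1)])
      fix e :: real assume "e > 0"
      then obtain N where N: "\<And>m n. m \<ge> N \<Longrightarrow> n \<ge> N \<Longrightarrow> norm (u m - u n) < c * e"
        using CauchyD[OF LIMSEQ_imp_Cauchy[OF l], of "c * e"] \<open>c > 0\<close> by auto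
      have "l1_norm (\<lambda>i. a m i - a n i) \<le> e" if "m \<ge> N" "n \<ge> N" for m n
      proof -
        have "l1_norm (\<lambda>i. a m i - a n i) \<le> (1 / c) * norm (u m - u n)"
          using low[OF l1_diff[OF a(1) a(1), of m n]] Tdiff[OF a(1) a(1), of m n] by (simp add: a(2))
        also have "\<dots> \<le> e"
          using N[OF that] \<open>c > 0\<close> by (simp add: field_simps)
        finally show ?thesis .
      qed
      then show "\<exists>N. \<forall>m\<ge>N. \<forall>n\<ge>N. l1_norm (\<lambda>i. a m i - a n i) \<le> e"
        by blast
    qed
    have "norm (u n - T b) \<le> l1_norm (\<lambda>i. a n i - b i)" for n
      using upper[OF l1_diff[OF a(1) b(1), of n]] Tdiff[OF a(1) b(1), of n] by (simp add: a(2))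
    then have "(\<lambda>n. norm (u n - T b)) \<longlonglongrightarrow> 0"
      by (intro tendsto_sandwich[OF _ _ tendsto_const b(2)]) auto
    then have "u \<longlonglongrightarrow> T b"
      by (rule LIM_zero_cancel[OF tendsto_norm_zero_cancel])
    then have "l = T b"
      using l LIMSEQ_unique by blast
    then show "l \<in> T ` l1"
      using b(1) by blast
  qed
  ultimately show ?thesis
    unfolding contains_l1_def by (intro exI[of _ "T ` l1"] conjI)
qed

text \<open>
  Dor's argument for the complex case: the discs around \<open>c\<close> and \<open>d\<close> are small compared to their
  distance, so that the signs can be chosen according to the real or the imaginary parts of the
  coefficients, whichever dominate.
\<close>

lemma (in banach_space_over) contains_l1_if_independent:
  fixes x :: "nat \<Rightarrow> 'x" and \<Phi> :: "'w \<Rightarrow> nat \<Rightarrow> 'k" and \<phi> :: "'k \<Rightarrow> complex"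
  assumes \<phi>: "linear \<phi>" "\<And>x y. \<phi> (x * y) = \<phi> x * \<phi> y" "\<And>x. norm (\<phi> x) = norm x"
    and x: "\<And>n. norm (x n) \<le> 1"
    and dom: "\<And>w F a. w \<in> W \<Longrightarrow> finite F \<Longrightarrow>
      norm (\<Sum>i\<in>F. a i * \<Phi> w i) \<le> norm (\<Sum>i\<in>F. smul (a i) (x i))"
    and p: "strict_mono (p :: nat \<Rightarrow> nat)"
    and indep: "\<And>k P. \<exists>w\<in>W. \<forall>i<k. (i \<in> P \<longrightarrow> norm (\<phi> (\<Phi> w (p i)) - c) \<le> e) \<and>
        (i \<notin> P \<longrightarrow> norm (\<phi> (\<Phi> w (p i)) - d) \<le> e)"
    and e: "e > 0" "norm (c - d) \<ge> 20 * e"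
  shows "contains_l1 smul"
proof (rule contains_l1I)
  show "norm ((x \<circ> p) n) \<le> 1" for n
    using x by simp
  fix k :: nat and a :: "nat \<Rightarrow> 'k"
  define v where "v = (\<Sum>i<k. smul (a i) (x (p i)))"
  define S where "S = (\<Sum>i<k. norm (a i))"
  have ev: "norm (\<Sum>i<k. a i * \<Phi> w (p i)) \<le> norm v" if "w \<in> W" for w
  proof -
    have inj: "inj_on p {..<k}"
      using p by (simp add: inj_on_subset strict_mono_imp_inj_on)
    have "norm (\<Sum>j\<in>p ` {..<k}. a (inv p j) * \<Phi> w j) \<le> norm (\<Sum>j\<in>p ` {..<k}. smul (a (inv p j)) (x j))"
      using dom[OF that, of "p ` {..<k}" "\<lambda>j. a (inv p j)"] by simp
    then show ?thesis
      using p by (simp add: sum.reindex[OF inj] v_def inv_f_f strict_mono_imp_inj_on)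
  qed
  \<comment> \<open>To be used for the real and for the imaginary parts of the coefficients.
    \<open>w\<close> lies near \<open>c\<close> where \<open>t\<close> is nonnegative and near
    \<open>d\<close> elsewhere, \<open>w'\<close> the other way round; their values differ by plus
    or minus \<open>c - d\<close>, up to an error \<open>r\<close> of norm at most
    \<open>2 * e\<close>. \<open>proj\<close> leads from the signed sum of \<open>t\<close> back to
    the full coefficients.\<close>
  have two: "norm (c - d) * (\<Sum>i<k. \<bar>t i\<bar>) \<le> 2 * norm v + 2 * e * S"

    if proj: "\<And>s :: nat \<Rightarrow> real. \<bar>\<Sum>i<k. s i * t i\<bar> \<le> norm (\<Sum>i<k. of_real (s i) * \<phi> (a i))"
    for t :: "nat \<Rightarrow> real"
  proof -
    define P where "P = {i. t i \<ge> 0}"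
    obtain w where w: "w \<in> W" "\<And>i. i < k \<Longrightarrow> i \<in> P \<Longrightarrow> norm (\<phi> (\<Phi> w (p i)) - c) \<le> e"
        "\<And>i. i < k \<Longrightarrow> i \<notin> P \<Longrightarrow> norm (\<phi> (\<Phi> w (p i)) - d) \<le> e"
      using indep[of k P] by auto
    obtain w' where w': "w' \<in> W" "\<And>i. i < k \<Longrightarrow> i \<notin> P \<Longrightarrow> norm (\<phi> (\<Phi> w' (p i)) - c) \<le> e"
        "\<And>i. i < k \<Longrightarrow> i \<in> P \<Longrightarrow> norm (\<phi> (\<Phi> w' (p i)) - d) \<le> e"
      using indep[of k "- P"] by auto
    define s where "s i = (if i \<in> P then 1 else - 1 :: real)" for i
    define r where "r i = \<phi> (\<Phi> w (p i)) - \<phi> (\<Phi> w' (p i)) - of_real (s i) * (c - d)" for i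
    have r: "norm (r i) \<le> 2 * e" if "i < k" for i
    proof (cases "i \<in> P")
      case True
      have "r i = (\<phi> (\<Phi> w (p i)) - c) - (\<phi> (\<Phi> w' (p i)) - d)"
        using True by (simp add: r_def s_def)
      then show ?thesis
        using norm_triangle_ineq4[of "\<phi> (\<Phi> w (p i)) - c" "\<phi> (\<Phi> w' (p i)) - d"] w(2) w'(3) True that
        by fastforce
    next
      case False
      have "r i = (\<phi> (\<Phi> w (p i)) - d) - (\<phi> (\<Phi> w' (p i)) - c)"
        using False by (simp add: r_def s_def)
      then show ?thesis
        using norm_triangle_ineq4[of "\<phi> (\<Phi> w (p i)) - d" "\<phi> (\<Phi> w' (p i)) - c"] w(3) w'(2) False that
        by fastforce
    qed
    have im: "(\<Sum>i<k. \<phi> (a i) * \<phi> (\<Phi> u (p i))) = \<phi> (\<Sum>i<k. a i * \<Phi> u (p i))" for u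
      by (simp add: linear_sum[OF \<phi>(1)] \<phi>(2))
    have "(\<Sum>i<k. \<bar>t i\<bar>) = (\<Sum>i<k. s i * t i)"
      by (rule sum.cong) (auto simp: s_def P_def)
    also have "\<dots> \<le> norm (\<Sum>i<k. of_real (s i) * \<phi> (a i))"
      using proj[of s] by linarith
    finally have "norm (c - d) * (\<Sum>i<k. \<bar>t i\<bar>) \<le> norm (c - d) * norm (\<Sum>i<k. of_real (s i) * \<phi> (a i))"
      by (intro mult_left_mono) auto
    also have "\<dots> = norm ((\<Sum>i<k. \<phi> (a i) * \<phi> (\<Phi> w (p i))) - (\<Sum>i<k. \<phi> (a i) * \<phi> (\<Phi> w' (p i)))
        - (\<Sum>i<k. \<phi> (a i) * r i))"
      unfolding norm_mult[symmetric] sum_distrib_left sum_subtractf[symmetric] r_def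
      by (intro arg_cong[where f = norm] sum.cong) (auto simp: algebra_simps)
    also have "\<dots> \<le> norm v + norm v + 2 * e * S"
    proof -
      have "norm (\<Sum>i<k. \<phi> (a i) * r i) \<le> (\<Sum>i<k. norm (a i) * (2 * e))"
        by (rule sum_norm_le) (simp add: norm_mult \<phi>(3) mult_left_mono r)
      also have "\<dots> = 2 * e * S"
        unfolding S_def sum_distrib_right[symmetric] by simp
      finally show ?thesis
        using ev[OF w(1)] ev[OF w'(1)] unfolding im
        by (intro order_trans[OF norm_triangle_ineq4] add_mono) (auto simp: \<phi>(3))
    qed
    finally show ?thesis
      by simp
  qed
  have "norm (c - d) * (\<Sum>i<k. \<bar>Re (\<phi> (a i))\<bar>) \<le> 2 * norm v + 2 * e * S"
  proof -
    have "\<bar>\<Sum>i<k. s i * Re (\<phi> (a i))\<bar> \<le> norm (\<Sum>i<k. of_real (s i) * \<phi> (a i))" for s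
      using abs_Re_le_cmod[of "\<Sum>i<k. of_real (s i) * \<phi> (a i)"] by simp
    then show ?thesis
      using two[of "\<lambda>i. Re (\<phi> (a i))"] by (simp add: sum_nonneg)
  qed
  moreover have "norm (c - d) * (\<Sum>i<k. \<bar>Im (\<phi> (a i))\<bar>) \<le> 2 * norm v + 2 * e * S"
  proof -
    have "\<bar>\<Sum>i<k. s i * Im (\<phi> (a i))\<bar> \<le> norm (\<Sum>i<k. of_real (s i) * \<phi> (a i))" for s
      using abs_Im_le_cmod[of "\<Sum>i<k. of_real (s i) * \<phi> (a i)"] by simp
    then show ?thesis
      using two[of "\<lambda>i. Im (\<phi> (a i))"] by (simp add: sum_nonneg)
  qed
  moreover have "norm (c - d) * S \<le> norm (c - d) * (\<Sum>i<k. \<bar>Re (\<phi> (a i))\<bar>) + norm (c - d) * (\<Sum>i<k. \<bar>Im (\<phi> (a i))\<bar>)"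
    unfolding S_def sum.distrib[symmetric] distrib_left[symmetric]
    by (intro mult_left_mono sum_mono) (auto simp: cmod_le simp flip: \<phi>(3))
  \<comment> \<open>Real and imaginary parts together give at most
    \<open>4 * norm v + 4 * e * S\<close>; the separation by \<open>20 * e\<close> is large enough
    to absorb the second term.\<close>
  moreover have "20 * e * S \<le> norm (c - d) * S"
    using e(2) by (intro mult_right_mono) (auto simp: S_def sum_nonneg)
  ultimately have "20 * e * S \<le> 4 * norm v + 4 * e * S"
    by linarith
  then have "e * S \<le> norm v"
    using norm_ge_zero[of v] by linarith
  then show "e * (\<Sum>i<k. norm (a i)) \<le> norm (\<Sum>i<k. smul (a i) ((x \<circ> p) i))"
    by (simp add: S_def v_def)
qed (fact e(1))


text \<open>
  Rosenthal's \<open>\<ell>\<^sub>1\<close> theorem is the case where \<open>W\<close> is the dual ball. The generality saves the use of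
  the Banach-Alaoglu theorem later, where \<open>W\<close> is the set of branches of a tree of functionals.
\<close>

theorem (in banach_space_over) rosenthal:
  fixes x :: "nat \<Rightarrow> 'x" and \<Phi> :: "'w \<Rightarrow> nat \<Rightarrow> 'k"
  assumes no: "\<not> contains_l1 smul"
    and x: "\<And>n. norm (x n) \<le> 1"
    and dom: "\<And>w F a. w \<in> W \<Longrightarrow> finite F \<Longrightarrow>
      norm (\<Sum>i\<in>F. a i * \<Phi> w i) \<le> norm (\<Sum>i\<in>F. smul (a i) (x i))"
  obtains r where "strict_mono (r :: nat \<Rightarrow> nat)" "\<And>w. w \<in> W \<Longrightarrow> convergent (\<Phi> w \<circ> r)"
proof -
  obtain \<phi> :: "'k \<Rightarrow> complex" where \<phi>: "linear \<phi>" "\<And>x y. \<phi> (x * y) = \<phi> x * \<phi> y" "\<And>x. norm (\<phi> x) = norm x"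
    using scalar_embedding by metis
  have \<Phi>1: "norm (\<Phi> w n) \<le> 1" if "w \<in> W" for w n
    using dom[OF that, of "{n}" "\<lambda>_. 1"] x[of n] by simp
  obtain D :: "complex set" where D: "countable D" "\<And>X. open X \<Longrightarrow> X \<noteq> {} \<Longrightarrow> \<exists>d\<in>D. d \<in> X"
    using countable_dense_setE by blast
  \<comment> \<open>A countable supply of pairs of discs with centres in a dense set, well separated
    relative to their common radius. Any two distinct limits are caught by one of them.\<close>
  define Pairs where "Pairs = {(c, d, e). (c, d, e) \<in> D \<times> D \<times> range (\<lambda>n. 1 / real (Suc n)) \<and> norm (c - d) \<ge> 20 * e}"
  have "countable (D \<times> D \<times> range (\<lambda>n. 1 / real (Suc n)))"
    using D(1) by (intro countable_SIGMA) auto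
  then have "countable Pairs"
    by (rule countable_subset[rotated]) (auto simp: Pairs_def)
  define near where "near c e n = {w \<in> W. norm (\<phi> (\<Phi> w n) - c) \<le> e}" for c e n
  \<comment> \<open>Along \<open>N\<close>, no \<open>w\<close> visits both discs of the pair
    infinitely often. By \<open>ref\<close> this can be reached inside every infinite set, since
    otherwise an independent subsequence would produce \<open>l1\<close>.\<close>
  define Q where "Q t N \<longleftrightarrow> (case t of (c, d, e) \<Rightarrow>
    \<not> (\<exists>w. infinite {n\<in>N. w \<in> near c e n} \<and> infinite {n\<in>N. w \<in> near d e n}))" for t N
  have ref: "\<exists>N\<subseteq>M. infinite N \<and> Q t N" if "t \<in> Pairs" "infinite M" for t M
  proof (rule ccontr)
    assume nQ: "\<not> (\<exists>N\<subseteq>M. infinite N \<and> Q t N)"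
    obtain c d e where t: "t = (c, d, e)"
      by (cases t)
    have e: "e > 0" "norm (c - d) \<ge> 20 * e"
      using that(1) by (auto simp: t Pairs_def)
    have AB: "\<exists>w. infinite {n\<in>N. w \<in> near c e n} \<and> infinite {n\<in>N. w \<in> near d e n}"
      if "N \<subseteq> M" "infinite N" for N
      using nQ that by (auto simp: t Q_def)
    obtain p where p: "strict_mono (p :: nat \<Rightarrow> nat)"
      and ind: "\<forall>k P. \<exists>w. \<forall>i<k. (i \<in> P \<longrightarrow> w \<in> near c e (p i)) \<and> (i \<notin> P \<longrightarrow> w \<in> near d e (p i))"
      by (rule independent_subsequence[OF \<open>infinite M\<close> AB]) blast
    have ind': "\<exists>w\<in>W. \<forall>i<k. (i \<in> P \<longrightarrow> norm (\<phi> (\<Phi> w (p i)) - c) \<le> e) \<and>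
        (i \<notin> P \<longrightarrow> norm (\<phi> (\<Phi> w (p i)) - d) \<le> e)" for k P
    proof -
      \<comment> \<open>Membership of \<open>w\<close> in \<open>W\<close> is read off at index 0,
        so one index more than \<open>k\<close> is requested in case \<open>k\<close> is 0.\<close>
      obtain w where w: "\<forall>i<Suc k. (i \<in> P \<longrightarrow> w \<in> near c e (p i)) \<and> (i \<notin> P \<longrightarrow> w \<in> near d e (p i))"
        using ind by blast
      have "w \<in> W"
        using w[rule_format, of 0] by (auto simp: near_def)
      then show ?thesis
        using w by (intro bexI[of _ w]) (auto simp: near_def)
    qed
    have "contains_l1 smul"
      by (rule contains_l1_if_independent[where \<phi> = \<phi> and x = x and \<Phi> = \<Phi> and W = W and p = p and c = c and d = d and e = e])
        (fact \<phi> x dom p ind' e)+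
    with no show False ..
  qed
  have Qtail: "Q t M" if "finite s" "Q t (M \<inter> {n. \<forall>m\<in>s. m < n})" for s M t
  proof -
    obtain c d e where t: "t = (c, d, e)"
      by (cases t)
    have "infinite {n \<in> M \<inter> {n. \<forall>m\<in>s. m < n}. w \<in> near c e n}"
      if "infinite {n \<in> M. w \<in> near c e n}" for w c
    proof -
      have "{n \<in> M \<inter> {n. \<forall>m\<in>s. m < n}. w \<in> near c e n} = {n \<in> M. w \<in> near c e n} \<inter> {n. \<forall>m\<in>s. m < n}"
        by auto
      then show ?thesis
        using infinite_Int_above[OF \<open>finite s\<close> that] by simp
    qed
    then show ?thesis
      using that(2) unfolding t Q_def prod.case by blast
  qed
  have Qmono: "Q t N" if "Q t M" "N \<subseteq> M" for t M N
  proof -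
    obtain c d e where t: "t = (c, d, e)"
      by (cases t)
    have "infinite {n \<in> M. w \<in> near c e n}" if "infinite {n \<in> N. w \<in> near c e n}" for w c
      by (rule infinite_super[OF _ that]) (use \<open>N \<subseteq> M\<close> in auto)
    then show ?thesis
      using that(1) unfolding t Q_def prod.case by blast
  qed
  obtain u :: "nat \<Rightarrow> complex \<times> complex \<times> real" where u: "Pairs \<subseteq> range u" "Pairs \<noteq> {} \<Longrightarrow> range u \<subseteq> Pairs"
    using range_from_nat_into[OF _ \<open>countable Pairs\<close>] by (cases "Pairs = {}") auto
  \<comment> \<open>The fusion lemma handles conditions indexed by finite sets. Indexing the pairs
    by \<open>card s\<close> fits them in, because an infinite \<open>N\<close> has finite subsets
    of every cardinality.\<close>
  obtain N :: "nat set" where N: "infinite N" "\<And>s. finite s \<Longrightarrow> s \<subseteq> N \<Longrightarrow> u (card s) \<in> Pairs \<longrightarrow> Q (u (card s)) N"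
  proof (rule diagonal_infinite_set[of "\<lambda>s N. u (card s) \<in> Pairs \<longrightarrow> Q (u (card s)) N" "UNIV :: nat set"])
    fix s M :: "nat set" assume "finite s" "infinite M"
    then show "\<exists>N\<subseteq>M. infinite N \<and> (u (card s) \<in> Pairs \<longrightarrow> Q (u (card s)) N)"
      using ref[of "u (card s)" M] by blast
  next
    show "u (card s) \<in> Pairs \<longrightarrow> Q (u (card s)) N"
      if "u (card s) \<in> Pairs \<longrightarrow> Q (u (card s)) M" "N \<subseteq> M" for s M N :: "nat set"
      using that Qmono by metis
    show "u (card s) \<in> Pairs \<longrightarrow> Q (u (card s)) M"
      if "finite s" "u (card s) \<in> Pairs \<longrightarrow> Q (u (card s)) (M \<inter> {n. \<forall>m\<in>s. m < n})" for s M :: "nat set"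
      using that Qtail by metis
  qed auto
  have QN: "Q t N" if "t \<in> Pairs" for t
  proof -
    obtain i where i: "t = u i"
      using u(1) \<open>t \<in> Pairs\<close> by auto
    obtain s where "finite s" "card s = i" "s \<subseteq> N"
      using infinite_arbitrarily_large[OF N(1)] by metis
    with N(2)[of s] i that show ?thesis
      by auto
  qed
  show ?thesis
  proof (rule that[of "enumerate N"])
    show "strict_mono (enumerate N)"
      using N(1) by (rule strict_mono_enumerate)
    fix w assume w: "w \<in> W"
    show "convergent (\<Phi> w \<circ> enumerate N)"
    proof (rule ccontr)
      assume "\<not> convergent (\<Phi> w \<circ> enumerate N)"
      then obtain r s l l' where rs: "strict_mono (r :: nat \<Rightarrow> nat)" "strict_mono (s :: nat \<Rightarrow> nat)"
        and lim: "((\<Phi> w \<circ> enumerate N) \<circ> r) \<longlonglongrightarrow> l" "((\<Phi> w \<circ> enumerate N) \<circ> s) \<longlonglongrightarrow> l'" and "l \<noteq> l'"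
        using scalar_two_limits[of "\<Phi> w \<circ> enumerate N" 1] \<Phi>1[OF w] by (metis comp_apply)
      define \<delta> where "\<delta> = norm (\<phi> l - \<phi> l')"
      have "\<delta> = norm (l - l')"
        by (simp add: \<delta>_def \<phi>(3) flip: linear_diff[OF \<phi>(1)])
      then have "\<delta> / 22 > 0"
        using \<open>l \<noteq> l'\<close> by simp
      \<comment> \<open>22 instead of 20 leaves room for replacing both limits by centres from
        \<open>D\<close> within \<open>e / 2\<close>, which costs \<open>e\<close> in the
        separation.\<close>
      then obtain n where n: "1 / real (Suc n) < \<delta> / 22"
        using nat_approx_posE by metis
      define e where "e = 1 / real (Suc n)"
      have e: "0 < e" "22 * e < \<delta>"
        using n by (auto simp: e_def)
      obtain c where c: "c \<in> D" "dist (\<phi> l) c < e / 2"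
        using D(2)[of "ball (\<phi> l) (e / 2)"] e(1) by auto
      obtain d where d: "d \<in> D" "dist (\<phi> l') d < e / 2"
        using D(2)[of "ball (\<phi> l') (e / 2)"] e(1) by auto
      have "\<delta> \<le> norm (c - d) + e"
        using dist_triangle[of "\<phi> l" "\<phi> l'" c] dist_triangle[of c "\<phi> l'" d] c(2) d(2)
        by (simp add: \<delta>_def dist_norm norm_minus_commute)
      then have "20 * e \<le> norm (c - d)"
        using e by linarith
      then have pairs: "(c, d, e) \<in> Pairs"
        using c(1) d(1) by (auto simp: Pairs_def e_def)
      have inf: "infinite {n \<in> N. w \<in> near b e n}"
        if q: "strict_mono (q :: nat \<Rightarrow> nat)" "((\<Phi> w \<circ> enumerate N) \<circ> q) \<longlonglongrightarrow> m" "dist (\<phi> m) b < e / 2" for q m b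
      proof -
        have "\<exists>k. \<forall>i\<ge>k. norm (((\<Phi> w \<circ> enumerate N) \<circ> q) i - m) < e / 2"
          using LIMSEQ_D[OF q(2), of "e / 2"] e(1) by auto
        then obtain k where k: "\<And>i. i \<ge> k \<Longrightarrow> norm (\<Phi> w (enumerate N (q i)) - m) < e / 2"
          by auto
        have "norm (\<phi> (\<Phi> w (enumerate N (q i))) - b) \<le> e" if "i \<ge> k" for i
        proof -
          have "norm (\<phi> (\<Phi> w (enumerate N (q i))) - \<phi> m) < e / 2"
            using k[OF that] by (simp add: \<phi>(3) flip: linear_diff[OF \<phi>(1)])
          then show ?thesis
            using q(3) norm_triangle_ineq[of "\<phi> (\<Phi> w (enumerate N (q i))) - \<phi> m" "\<phi> m - b"]
            by (simp add: dist_norm)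
        qed
        then have "(enumerate N \<circ> q) ` {k..} \<subseteq> {n \<in> N. w \<in> near b e n}"
          using w enumerate_in_set[OF N(1)] by (auto simp: near_def)
        moreover have "inj_on (enumerate N \<circ> q) {k..}"
          using strict_mono_o[OF strict_mono_enumerate[OF N(1)] q(1)]
          by (meson inj_on_subset strict_mono_imp_inj_on top_greatest)
        then have "infinite ((enumerate N \<circ> q) ` {k..})"
          using finite_imageD infinite_Ici by blast
        ultimately show ?thesis
          using finite_subset by blast
      qed
      show False
        using QN[OF pairs] inf[OF rs(1) lim(1) c(2)] inf[OF rs(2) lim(2) d(2)]
        unfolding Q_def prod.case by blast
    qed
  qed
qed

subsection \<open>Weak* convergent convex block subsequences\<close>

text \<open>
  A transitive substitute for \<^const>\<open>cbs\<close>: blocks may overlap.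
\<close>

definition subord :: "(nat \<Rightarrow> 'v::real_vector) \<Rightarrow> (nat \<Rightarrow> 'v) \<Rightarrow> bool" where
  "subord h g \<longleftrightarrow> (\<forall>i. h i \<in> convex hull (g ` {i..}))"

lemma subord_subseq: "strict_mono r \<Longrightarrow> subord (g \<circ> r) g"
  unfolding subord_def by (auto intro!: hull_inc imageI simp: seq_suble)

lemma subord_refl: "subord g g"
  unfolding subord_def by (auto intro!: hull_inc)

lemma subord_shift: "subord h g \<Longrightarrow> subord (\<lambda>i. h (i + k)) (\<lambda>i. g (i + k))"
proof -
  have "(\<lambda>i. g (i + k)) ` {i..} = g ` ((+) k ` {i..})" for i
    by (simp only: image_image add.commute)
  then have "(\<lambda>i. g (i + k)) ` {i..} = g ` {i + k..}" for i
    by (simp only: image_add_atLeast add.commute[of k])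
  then show "subord h g \<Longrightarrow> subord (\<lambda>i. h (i + k)) (\<lambda>i. g (i + k))"
    by (simp add: subord_def)
qed

lemma subord_tail_hull:
  assumes "subord h g" "i \<le> j"
  shows "h j \<in> convex hull (g ` {i..})"
proof -
  have "convex hull (g ` {j..}) \<subseteq> convex hull (g ` {i..})"
    using assms(2) by (intro hull_mono image_mono) auto
  then show ?thesis
    using assms(1) by (auto simp: subord_def)
qed

lemma subord_trans:
  assumes "subord h g" "subord g f"
  shows "subord h f"
  unfolding subord_def
proof
  fix i
  have "g ` {i..} \<subseteq> convex hull (f ` {i..})"
    using subord_tail_hull[OF assms(2)] by auto
  then have "convex hull (g ` {i..}) \<subseteq> convex hull (f ` {i..})"
    by (intro hull_minimal) auto
  then show "h i \<in> convex hull (f ` {i..})"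
    using assms(1) by (auto simp: subord_def)
qed

lemma subord_in_convex:
  assumes "subord h g" "convex C" "\<And>n. g n \<in> C"
  shows "h n \<in> C"
proof -
  have "convex hull (g ` {n..}) \<subseteq> C"
    using assms(2,3) by (intro hull_minimal) auto
  then show ?thesis
    using assms(1) by (auto simp: subord_def)
qed

text \<open>A ball around the limit pulls back under evaluation at \<open>x\<close> to a convex set
  of functionals, so the hulls of late tails stay inside it.\<close>

lemma subord_limit:
  fixes g h :: "nat \<Rightarrow> 'x::real_normed_vector \<Rightarrow>\<^sub>L 'k::real_normed_vector"
  assumes "subord h g" and lim: "(\<lambda>n. g n x) \<longlonglongrightarrow> l"
  shows "(\<lambda>n. h n x) \<longlonglongrightarrow> l"
  unfolding tendsto_iff
proof (intro allI impI)
  fix e :: real assume "e > 0"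
  define C where "C = (\<lambda>f. blinfun_apply f x) -` ball l e"
  have C: "convex C"
    unfolding C_def using bounded_linear.linear[OF blinfun.bounded_linear_left]
    by (intro convex_linear_vimage) auto
  obtain N where N: "\<And>n. n \<ge> N \<Longrightarrow> dist (g n x) l < e"
    using lim \<open>e > 0\<close> unfolding lim_sequentially by blast
  have "h n \<in> C" if "n \<ge> N" for n
  proof -
    have "convex hull (g ` {n..}) \<subseteq> C"
      using N that by (intro hull_minimal C) (auto simp: C_def dist_commute)
    then show ?thesis
      using assms(1) by (auto simp: subord_def)
  qed
  then show "\<forall>\<^sub>F n in sequentially. dist (h n x) l < e"
    by (auto simp: C_def dist_commute eventually_sequentially)
qed

text \<open>The weights sit on indices, not on points, so that they can be transferred to other
  sequences over the same indices.\<close>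

lemma convex_hull_imageE:
  assumes "y \<in> convex hull (f ` S)"
  obtains T w where "finite T" "T \<subseteq> S" "\<And>t. t \<in> T \<Longrightarrow> 0 \<le> w t" "sum w T = 1"
    "y = (\<Sum>t\<in>T. w t *\<^sub>R f t)"
proof -
  obtain U u where U: "finite U" "U \<subseteq> f ` S" "\<forall>x\<in>U. 0 \<le> u x" "sum u U = 1" "(\<Sum>v\<in>U. u v *\<^sub>R v) = y"
    using assms unfolding convex_hull_explicit by blast
  obtain T where T: "T \<subseteq> S" "inj_on f T" "U = f ` T"
    using U(2) unfolding subset_image_inj by blast
  show ?thesis
  proof (rule that[of T "u \<circ> f"])
    show "finite T"
      using U(1) T(2,3) finite_image_iff by blast
  qed (use U T in \<open>auto simp: sum.reindex\<close>)
qed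

lemma subord_average:
  assumes "finite I" "I \<noteq> {}" "\<And>i. i \<in> I \<Longrightarrow> subord (h i) g"
  shows "subord (\<lambda>j. \<Sum>i\<in>I. (1 / card I) *\<^sub>R h i j) g"
  unfolding subord_def
proof
  fix j
  show "(\<Sum>i\<in>I. (1 / card I) *\<^sub>R h i j) \<in> convex hull (g ` {j..})"
    using assms by (intro convex_sum) (auto simp: subord_def)
qed

text \<open>The weights that express \<open>u n\<close> through the averages are applied to every
  \<open>h i\<close> separately; exchanging the two finite sums recovers \<open>u n\<close>.\<close>

lemma subord_average_split:
  assumes "subord u (\<lambda>j. \<Sum>i\<in>I. c *\<^sub>R h i j)"
  obtains v where "\<And>i. subord (v i) (h i)" "\<And>n. u n = (\<Sum>i\<in>I. c *\<^sub>R v i n)"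
proof -
  have "\<forall>n. \<exists>p. finite (fst p) \<and> fst p \<subseteq> {n..} \<and> (\<forall>t\<in>fst p. 0 \<le> snd p t) \<and> sum (snd p) (fst p) = 1 \<and>
      u n = (\<Sum>t\<in>fst p. snd p t *\<^sub>R (\<Sum>i\<in>I. c *\<^sub>R h i t))"
  proof
    fix n
    have "u n \<in> convex hull ((\<lambda>j. \<Sum>i\<in>I. c *\<^sub>R h i j) ` {n..})"
      using assms by (simp add: subord_def)
    then obtain T w where "finite T" "T \<subseteq> {n..}" "\<And>t. t \<in> T \<Longrightarrow> 0 \<le> w t" "sum w T = 1"
        "u n = (\<Sum>t\<in>T. w t *\<^sub>R (\<Sum>i\<in>I. c *\<^sub>R h i t))"
      by (rule convex_hull_imageE) blast
    then show "\<exists>p. finite (fst p) \<and> fst p \<subseteq> {n..} \<and> (\<forall>t\<in>fst p. 0 \<le> snd p t) \<and> sum (snd p) (fst p) = 1 \<and>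
      u n = (\<Sum>t\<in>fst p. snd p t *\<^sub>R (\<Sum>i\<in>I. c *\<^sub>R h i t))"
      by (intro exI[of _ "(T, w)"]) simp
  qed
  then obtain p where "\<forall>n. finite (fst (p n)) \<and> fst (p n) \<subseteq> {n..} \<and> (\<forall>t\<in>fst (p n). 0 \<le> snd (p n) t) \<and>
      sum (snd (p n)) (fst (p n)) = 1 \<and> u n = (\<Sum>t\<in>fst (p n). snd (p n) t *\<^sub>R (\<Sum>i\<in>I. c *\<^sub>R h i t))"
    by (rule choice[THEN exE])
  then have p: "\<And>n. finite (fst (p n))" "\<And>n. fst (p n) \<subseteq> {n..}"
      "\<And>n t. t \<in> fst (p n) \<Longrightarrow> 0 \<le> snd (p n) t" "\<And>n. sum (snd (p n)) (fst (p n)) = 1"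
      "\<And>n. u n = (\<Sum>t\<in>fst (p n). snd (p n) t *\<^sub>R (\<Sum>i\<in>I. c *\<^sub>R h i t))"
    by blast+
  define v where "v i n = (\<Sum>t\<in>fst (p n). snd (p n) t *\<^sub>R h i t)" for i n
  show ?thesis
  proof (rule that[of v])
    show "subord (v i) (h i)" for i
      unfolding subord_def v_def
    proof (intro allI convex_sum p convex_convex_hull)
      show "h i t \<in> convex hull h i ` {n..}" if "t \<in> fst (p n)" for t n
        using that p(2)[of n] by (intro hull_inc) auto
    qed
    have "u n = (\<Sum>t\<in>fst (p n). \<Sum>i\<in>I. c *\<^sub>R (snd (p n) t *\<^sub>R h i t))" for n
      unfolding p(5)[of n] scaleR_sum_right by (simp add: mult.commute)
    then show "u n = (\<Sum>i\<in>I. c *\<^sub>R v i n)" for n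
      unfolding v_def scaleR_sum_right by (subst sum.swap) simp
  qed
qed

text \<open>Exhaustion with a diagonal: \<open>G (Suc n)\<close> nearly minimises \<open>F\<close>
  among the sequences subordinate to \<open>G n\<close>, and \<open>g i = G i i\<close>. Since
  \<open>F\<close> cannot drop on a shift, it is governed by tails, and a tail of any
  \<open>h\<close> below \<open>g\<close> still competes in the infimum for
  \<open>G n\<close>.\<close>

lemma subord_stabilise:
  fixes F :: "(nat \<Rightarrow> 'v::real_vector) \<Rightarrow> real"
  assumes P: "\<And>g h. P g \<Longrightarrow> subord h g \<Longrightarrow> P h"
    and mono: "\<And>g h. P g \<Longrightarrow> subord h g \<Longrightarrow> F h \<le> F g"
    and nonneg: "\<And>g. P g \<Longrightarrow> 0 \<le> F g"
    and shift: "\<And>g k. P g \<Longrightarrow> F g \<le> F (\<lambda>i. g (i + k))"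
    and "P f"
  obtains g where "subord g f" "\<And>h. subord h g \<Longrightarrow> F h = F g"
proof -
  define Fm where "Fm g = Inf (F ` {h. subord h g})" for g
  have bdd: "bdd_below (F ` {h. subord h g})" if "P g" for g
    using nonneg P[OF that] by (auto intro!: bdd_belowI[of _ 0])
  define A where "A n g \<longleftrightarrow> P g \<and> (n = (0::nat) \<longrightarrow> g = f)" for n g
  define Q where "Q n g h \<longleftrightarrow> subord h g \<and> F h < Fm g + 1 / real (Suc n)" for n g h
  have "\<exists>G. \<forall>n. A n (G n) \<and> Q n (G n) (G (Suc n))"
  proof (rule dependent_nat_choice[of A Q])
    show "\<exists>g. A 0 g"
      using \<open>P f\<close> by (auto simp: A_def)
    fix g n assume "A n g"
    have "\<exists>y\<in>F ` {h. subord h g}. y < Fm g + 1 / real (Suc n)"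
      unfolding Fm_def using subord_refl[of g] by (intro cInf_lessD) auto
    then show "\<exists>h. A (Suc n) h \<and> Q n g h"
      using P \<open>A n g\<close> by (auto simp: A_def Q_def)
  qed
  then obtain G where G: "\<And>n. A n (G n)" "\<And>n. Q n (G n) (G (Suc n))"
    by metis
  have PG: "P (G n)" "G 0 = f" "subord (G (Suc n)) (G n)" "F (G (Suc n)) < Fm (G n) + 1 / real (Suc n)" for n
    using G(1)[of n] G(1)[of 0] G(2)[of n] by (simp_all add: A_def Q_def)
  have GG: "subord (G n) (G m)" if "m \<le> n" for m n
    using that by (induction n rule: dec_induct) (auto intro: subord_refl subord_trans PG)
  define g where "g i = G i i" for i
  \<comment> \<open>The diagonal sequence is below \<open>G k\<close> only from position
    \<open>k\<close> on, which is why \<open>shift\<close> is assumed.\<close>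
  have gG: "subord (\<lambda>i. g (i + k)) (G k)" for k
    unfolding subord_def g_def by (simp add: subord_tail_hull[OF GG])
  have gf: "subord g f"
    using gG[of 0] PG by simp
  have Pg: "P g"
    using P[OF \<open>P f\<close> gf] .
  show ?thesis
  proof (rule that[OF gf])
    fix h assume h: "subord h g"
    have Ph: "P h"
      using P[OF Pg h] .
    have "F g \<le> F h + 1 / real (Suc n)" for n
    proof -
      have sh: "subord (\<lambda>i. h (i + Suc n)) (\<lambda>i. g (i + Suc n))"
        using h by (rule subord_shift)
      have "F g \<le> F (\<lambda>i. g (i + Suc n))"
        using shift[OF Pg] .
      also have "\<dots> \<le> F (G (Suc n))"
        using mono[OF PG(1) gG] .
      also have "\<dots> \<le> Fm (G n) + 1 / real (Suc n)"
        using PG(4) by (rule less_imp_le)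
      also have "Fm (G n) \<le> F (\<lambda>i. h (i + Suc n))"
        unfolding Fm_def using subord_trans[OF subord_trans[OF sh gG] PG(3)]
        by (intro cInf_lower bdd PG imageI) simp
      also have "\<dots> \<le> F h"
        using subord_subseq[of "\<lambda>i. i + Suc n" h]
        by (intro mono Ph) (simp add: o_def strict_mono_def)
      finally show ?thesis
        by simp
    qed
    then have "F g \<le> F h + e" if "e > 0" for e
      using nat_approx_posE[OF that] by (meson add_left_mono less_imp_le order_trans)
    then have "F g \<le> F h"
      by (rule field_le_epsilon)
    with mono[OF Pg h] show "F h = F g"
      by simp
  qed
qed

section \<open>Oscillation of functionals along subordinate sequences\<close>

lemma finite_family_convergent_subseq:
  fixes z :: "'i \<Rightarrow> nat \<Rightarrow> 'k::real_or_complex"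
  assumes "finite I" "\<And>i n. i \<in> I \<Longrightarrow> norm (z i n) \<le> C"
  shows "\<exists>r. strict_mono (r :: nat \<Rightarrow> nat) \<and> (\<forall>i\<in>I. convergent (z i \<circ> r))"
  using assms
proof (induction I)
  case empty
  then show ?case
    by (auto intro: exI[of _ id] simp: strict_mono_def)
next
  case (insert i I)
  then obtain r where r: "strict_mono (r :: nat \<Rightarrow> nat)" "\<forall>i\<in>I. convergent (z i \<circ> r)"
    using insert.IH insert.prems by blast
  obtain l s where s: "strict_mono (s :: nat \<Rightarrow> nat)" "((z i \<circ> r) \<circ> s) \<longlonglongrightarrow> l"
    using scalar_bounded_convergent_subseq[of "z i \<circ> r" C] insert.prems by (metis comp_apply insertI1)
  have "convergent (z j \<circ> (r \<circ> s))" if "j \<in> insert i I" for j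
  proof (cases "j = i")
    case True
    then show ?thesis
      using s(2) by (auto simp: convergent_def o_assoc)
  next
    case False
    then show ?thesis
      using convergent_subseq_convergent[OF _ s(1)] r(2) that by (metis insertE o_assoc)
  qed
  then show ?case
    using strict_mono_o[OF r(1) s(1)] by blast
qed

text \<open>A replacement for the gap between upper and lower limit at points of the unit ball that
  also makes sense for complex scalars: distances between any two limits attained by subordinate
  sequences at a common point. Transitivity of \<open>subord\<close> makes it monotone.\<close>

definition oscset :: "(nat \<Rightarrow> 'x::real_normed_vector \<Rightarrow>\<^sub>L 'k::real_normed_vector) \<Rightarrow> real set" where
  "oscset g = {norm (b - a) | a b. \<exists>x h h'. norm x \<le> 1 \<and> subord h g \<and> subord h' g \<and>
     (\<lambda>n. h n x) \<longlonglongrightarrow> a \<and> (\<lambda>n. h' n x) \<longlonglongrightarrow> b}"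

definition osc :: "(nat \<Rightarrow> 'x::real_normed_vector \<Rightarrow>\<^sub>L 'k::real_normed_vector) \<Rightarrow> real" where
  "osc g = Sup (oscset g)"

lemma oscset_mono: "subord h g \<Longrightarrow> oscset h \<subseteq> oscset g"
  unfolding oscset_def using subord_trans by blast

lemma zero_in_oscset: "0 \<in> oscset g"
  unfolding oscset_def using subord_refl[of g]
  by (auto intro!: exI[of _ 0] exI[of _ g] simp: zero_blinfun.rep_eq blinfun.zero_right)

lemma norm_blinfun_le: "norm (f x) \<le> norm x" if "norm f \<le> 1"
  for f :: "'x::real_normed_vector \<Rightarrow>\<^sub>L 'k::real_normed_vector"
  using norm_blinfun[of f x] mult_right_mono[OF that, of "norm x"] by simp

lemma subord_norm_le:
  assumes "subord h g" "\<And>n. norm (g n) \<le> 1"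
  shows "norm (h n) \<le> 1"
  using subord_in_convex[OF assms(1) convex_cball[of 0 1]] assms(2) by simp

lemma oscset_le:
  assumes g: "\<And>n. norm (g n) \<le> 1" and "d \<in> oscset g"
  shows "d \<le> 2"
proof -
  obtain a b x h h' where *: "d = norm (b - a)" "norm x \<le> 1" "subord h g" "subord h' g"
      "(\<lambda>n. h n x) \<longlonglongrightarrow> a" "(\<lambda>n. h' n x) \<longlonglongrightarrow> b"
    using assms(2) unfolding oscset_def by blast
  have 1: "norm (h n x) \<le> 1" if "subord h g" for h n
    using norm_blinfun_le[OF subord_norm_le[OF that g], of n x] *(2) by simp
  have "norm a \<le> 1" "norm b \<le> 1"
    using 1[OF *(3)] 1[OF *(4)] by (auto intro: LIMSEQ_le_const2[OF tendsto_norm[OF *(5)]] LIMSEQ_le_const2[OF tendsto_norm[OF *(6)]])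
  then show ?thesis
    using norm_triangle_ineq4[of b a] *(1) by linarith
qed

lemma oscset_bdd:
  assumes "\<And>n. norm (g n) \<le> 1"
  shows "bdd_above (oscset g)"
  using oscset_le[OF assms] by (rule bdd_aboveI)

lemma le_osc:
  assumes "\<And>n. norm (g n) \<le> 1" "d \<in> oscset g"
  shows "d \<le> osc g"
  unfolding osc_def using assms(2) oscset_bdd[OF assms(1)] by (rule cSup_upper)

lemma osc_stabilise:
  fixes f :: "nat \<Rightarrow> 'x::real_normed_vector \<Rightarrow>\<^sub>L 'k::real_normed_vector"
  assumes "\<And>n. norm (f n) \<le> 1"
  obtains g where "subord g f" "\<And>h. subord h g \<Longrightarrow> osc h = osc g"
proof (rule subord_stabilise[of "\<lambda>g. \<forall>n. norm (g n) \<le> 1" osc f])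
  fix g h :: "nat \<Rightarrow> 'x \<Rightarrow>\<^sub>L 'k" assume g: "\<forall>n. norm (g n) \<le> 1"
  {
    assume h: "subord h g"
    then show "\<forall>n. norm (h n) \<le> 1"
      using subord_norm_le g by blast
    show "osc h \<le> osc g"
      unfolding osc_def using zero_in_oscset oscset_bdd[of g] g oscset_mono[OF h]
      by (intro cSup_subset_mono) auto
  }
  show "0 \<le> osc g"
    using le_osc[OF _ zero_in_oscset] g by blast
  fix k
  have shift_lim: "(\<lambda>n. u (n + k) x) \<longlonglongrightarrow> a" if "(\<lambda>n. u n x) \<longlonglongrightarrow> a" for u :: "nat \<Rightarrow> 'x \<Rightarrow>\<^sub>L 'k" and x a
    using that by (rule LIMSEQ_ignore_initial_segment)
  have "oscset g \<subseteq> oscset (\<lambda>i. g (i + k))"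
  proof
    fix d assume "d \<in> oscset g"
    then obtain a b x h h' where *: "d = norm (b - a)" "norm x \<le> 1" "subord h g" "subord h' g"
        "(\<lambda>n. h n x) \<longlonglongrightarrow> a" "(\<lambda>n. h' n x) \<longlonglongrightarrow> b"
      unfolding oscset_def by blast
    then show "d \<in> oscset (\<lambda>i. g (i + k))"
      using subord_shift[OF *(3), of k] subord_shift[OF *(4), of k] shift_lim[OF *(5)] shift_lim[OF *(6)]
      unfolding oscset_def by blast
  qed
  then show "osc g \<le> osc (\<lambda>i. g (i + k))"
    unfolding osc_def using zero_in_oscset[of g] oscset_bdd[of "\<lambda>i. g (i + k)"] g
    by (intro cSup_subset_mono) auto
qed (use assms that in auto)

text \<open>
  A single \<open>x\<close> splits all \<open>h i\<close> at once: choose \<open>x\<close> for the average of the \<open>h i\<close>, whose oscillation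
  is also \<open>\<delta>\<close>. As no \<open>h i\<close> oscillates by more than \<open>\<delta>\<close>, each of them must oscillate almost that much.
\<close>

lemma osc_split:
  fixes g :: "nat \<Rightarrow> 'x::real_normed_vector \<Rightarrow>\<^sub>L 'k::real_or_complex"
  assumes g: "\<And>n. norm (g n) \<le> 1" and stable: "\<And>h. subord h g \<Longrightarrow> osc h = \<delta>" and "\<delta> > 0"
    and I: "finite I" "I \<noteq> {}" and h: "\<And>i. i \<in> I \<Longrightarrow> subord (h i) g"
  obtains x u v a b where "norm x \<le> 1"
    "\<And>i. i \<in> I \<Longrightarrow> subord (u i) (h i)" "\<And>i. i \<in> I \<Longrightarrow> subord (v i) (h i)"
    "\<And>i. i \<in> I \<Longrightarrow> (\<lambda>n. u i n x) \<longlonglongrightarrow> b i" "\<And>i. i \<in> I \<Longrightarrow> (\<lambda>n. v i n x) \<longlonglongrightarrow> a i"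
    "\<And>i. i \<in> I \<Longrightarrow> norm (b i - a i) \<ge> \<delta> / 2"
proof -
  define m where "m = card I"
  have m: "m > 0"
    using I by (simp add: m_def card_gt_0_iff)
  define A where "A j = (\<Sum>i\<in>I. (1 / real m) *\<^sub>R h i j)" for j
  have Ag: "subord A g"
    unfolding A_def m_def using I h by (rule subord_average)
  \<comment> \<open>The defect is calibrated to \<open>m\<close> terms: if the average oscillates by
    \<open>d\<close> and the other \<open>m - 1\<close> terms by at most \<open>\<delta>\<close>,
    the remaining one keeps at least \<open>m * d - (m - 1) * \<delta>\<close>, which exceeds
    \<open>\<delta> / 2\<close>.\<close>
  have "\<delta> - \<delta> / (2 * m) < Sup (oscset A)"
    using stable[OF Ag] m \<open>\<delta> > 0\<close> by (simp add: osc_def)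
  then obtain d where d: "d \<in> oscset A" "\<delta> - \<delta> / (2 * m) < d"
    using less_cSupD[OF _ \<open>_ < Sup (oscset A)\<close>] zero_in_oscset by blast
  then obtain a0 b0 x u0 v0 where *: "d = norm (b0 - a0)" "norm x \<le> 1" "subord v0 A" "subord u0 A"
      "(\<lambda>n. v0 n x) \<longlonglongrightarrow> a0" "(\<lambda>n. u0 n x) \<longlonglongrightarrow> b0"
    unfolding oscset_def by blast
  obtain u1 where u1: "\<And>i. subord (u1 i) (h i)" "\<And>n. u0 n = (\<Sum>i\<in>I. (1 / real m) *\<^sub>R u1 i n)"
    using subord_average_split[OF *(4)[unfolded A_def]] by metis
  obtain v1 where v1: "\<And>i. subord (v1 i) (h i)" "\<And>n. v0 n = (\<Sum>i\<in>I. (1 / real m) *\<^sub>R v1 i n)"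
    using subord_average_split[OF *(3)[unfolded A_def]] by metis
  have bd: "norm (w n x) \<le> 1" if "subord w (h i)" "i \<in> I" for w i n
    using norm_blinfun_le[OF subord_norm_le[OF subord_trans[OF that(1) h[OF that(2)]] g], of n x] *(2) by simp
  \<comment> \<open>Convergence of the averages at \<open>x\<close> does not give convergence of the
    single summands, hence the passage to subsequences.\<close>
  obtain r where r: "strict_mono (r :: nat \<Rightarrow> nat)" "\<And>i. i \<in> I \<Longrightarrow> convergent ((\<lambda>n. u1 i n x) \<circ> r)"
    using finite_family_convergent_subseq[OF I(1), of "\<lambda>i n. u1 i n x" 1] bd[OF u1(1)] by blast
  obtain s where s: "strict_mono (s :: nat \<Rightarrow> nat)" "\<And>i. i \<in> I \<Longrightarrow> convergent ((\<lambda>n. v1 i n x) \<circ> s)"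
    using finite_family_convergent_subseq[OF I(1), of "\<lambda>i n. v1 i n x" 1] bd[OF v1(1)] by blast
  define u where "u i = u1 i \<circ> r" for i
  define v where "v i = v1 i \<circ> s" for i
  have uh: "subord (u i) (h i)" and vh: "subord (v i) (h i)" for i
    unfolding u_def v_def using subord_trans[OF subord_subseq] r(1) s(1) u1(1) v1(1) by blast+
  have "\<exists>b. \<forall>i\<in>I. (\<lambda>n. u i n x) \<longlonglongrightarrow> b i"
    using r(2) unfolding convergent_def u_def o_def by (intro bchoice) simp
  then obtain b where b: "\<And>i. i \<in> I \<Longrightarrow> (\<lambda>n. u i n x) \<longlonglongrightarrow> b i"
    by blast
  have "\<exists>a. \<forall>i\<in>I. (\<lambda>n. v i n x) \<longlonglongrightarrow> a i"
    using s(2) unfolding convergent_def v_def o_def by (intro bchoice) simp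
  then obtain a where a: "\<And>i. i \<in> I \<Longrightarrow> (\<lambda>n. v i n x) \<longlonglongrightarrow> a i"
    by blast
  have ap: "(\<Sum>i\<in>I. c *\<^sub>R w i) x = (\<Sum>i\<in>I. c *\<^sub>R w i x)" for c and w :: "'a \<Rightarrow> 'x \<Rightarrow>\<^sub>L 'k"
    by (simp add: blinfun.sum_left blinfun.scaleR_left)
  have "(\<lambda>n. u0 (r n) x) \<longlonglongrightarrow> (\<Sum>i\<in>I. (1 / real m) *\<^sub>R b i)"
    unfolding u1(2) ap using b by (intro tendsto_sum tendsto_scaleR tendsto_const) (simp add: u_def)
  moreover have "(\<lambda>n. u0 (r n) x) \<longlonglongrightarrow> b0"
    using LIMSEQ_subseq_LIMSEQ[OF *(6) r(1)] by (simp add: o_def)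
  ultimately have b0: "b0 = (\<Sum>i\<in>I. (1 / real m) *\<^sub>R b i)"
    using LIMSEQ_unique by blast
  have "(\<lambda>n. v0 (s n) x) \<longlonglongrightarrow> (\<Sum>i\<in>I. (1 / real m) *\<^sub>R a i)"
    unfolding v1(2) ap using a by (intro tendsto_sum tendsto_scaleR tendsto_const) (simp add: v_def)
  moreover have "(\<lambda>n. v0 (s n) x) \<longlonglongrightarrow> a0"
    using LIMSEQ_subseq_LIMSEQ[OF *(5) s(1)] by (simp add: o_def)
  ultimately have a0: "a0 = (\<Sum>i\<in>I. (1 / real m) *\<^sub>R a i)"
    using LIMSEQ_unique by blast
  have le: "norm (b i - a i) \<le> \<delta>" if "i \<in> I" for i
  proof -
    have "norm (b i - a i) \<in> oscset (h i)"
      unfolding oscset_def using *(2) uh vh a[OF that] b[OF that] by blast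
    then show ?thesis
      using le_osc[of "h i", OF subord_norm_le[OF h[OF that] g]] stable[OF h[OF that]] by metis
  qed
  have "norm (b i - a i) \<ge> \<delta> / 2" if "i \<in> I" for i
  proof -
    have "m * d = norm (real m *\<^sub>R (b0 - a0))"
      using *(1) by simp
    also have "real m *\<^sub>R (b0 - a0) = (\<Sum>j\<in>I. b j - a j)"
      using m by (simp add: a0 b0 sum_subtractf flip: scaleR_sum_right scaleR_diff_right)
    also have "norm \<dots> \<le> (\<Sum>j\<in>I. norm (b j - a j))"
      by (rule norm_sum)
    also have "\<dots> = norm (b i - a i) + (\<Sum>j\<in>I - {i}. norm (b j - a j))"
      using I(1) that by (rule sum.remove)
    also have "(\<Sum>j\<in>I - {i}. norm (b j - a j)) \<le> real (card (I - {i})) * \<delta>"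
      using le by (intro sum_bounded_above) simp
    also have "real (card (I - {i})) = m - 1"
      using I(1) that m by (simp add: m_def)
    finally have "m * d \<le> norm (b i - a i) + (m - 1) * \<delta>"
      by simp
    moreover have "m * \<delta> - \<delta> / 2 < m * d"
      using d(2) m by (simp add: field_simps)
    moreover have "real (m - 1) * \<delta> = m * \<delta> - \<delta>"
      using m by (simp add: of_nat_diff algebra_simps)
    ultimately show ?thesis
      by simp
  qed
  then show ?thesis
    using that[OF *(2) uh vh b a] by blast
qed

text \<open>Two subsequences with different limits at a point, rescaled into the unit ball, would
  put a positive number into \<open>oscset g\<close>.\<close>

lemma osc_zero_convergent:
  fixes g :: "nat \<Rightarrow> 'x::real_normed_vector \<Rightarrow>\<^sub>L 'k::real_or_complex"
  assumes g: "\<And>n. norm (g n) \<le> 1" and "osc g \<le> 0"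
  shows "convergent (\<lambda>n. g n x)"
proof (rule ccontr)
  assume nc: "\<not> convergent (\<lambda>n. g n x)"
  define y where "y = (1 / (norm x + 1)) *\<^sub>R x"
  have gx: "g n x = (norm x + 1) *\<^sub>R g n y" for n
    by (simp add: y_def blinfun.scaleR_right add_nonneg_eq_0_iff)
  have ncy: "\<not> convergent (\<lambda>n. g n y)"
  proof
    assume "convergent (\<lambda>n. g n y)"
    then obtain l where "(\<lambda>n. g n y) \<longlonglongrightarrow> l"
      by (auto simp: convergent_def)
    then have "(\<lambda>n. g n x) \<longlonglongrightarrow> (norm x + 1) *\<^sub>R l"
      unfolding gx by (rule tendsto_scaleR[OF tendsto_const])
    with nc show False
      by (auto simp: convergent_def)
  qed
  have y: "norm y \<le> 1"
    using add_nonneg_pos[of "norm x" 1] by (simp add: y_def divide_le_eq_1)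
  then have bd: "norm (g n y) \<le> 1" for n
    using norm_blinfun_le[OF g, of n y] by simp
  obtain r s l l' where rs: "strict_mono (r :: nat \<Rightarrow> nat)" "strict_mono (s :: nat \<Rightarrow> nat)"
    and lim: "((\<lambda>n. g n y) \<circ> r) \<longlonglongrightarrow> l" "((\<lambda>n. g n y) \<circ> s) \<longlonglongrightarrow> l'" and "l \<noteq> l'"
    by (rule scalar_two_limits[OF bd ncy])
  have "norm (l' - l) \<in> oscset g"
    unfolding oscset_def using y subord_subseq[OF rs(1), of g] subord_subseq[OF rs(2), of g] lim
    unfolding o_def by blast
  then have "norm (l' - l) \<le> 0"
    using le_osc[of g, OF g] \<open>osc g \<le> 0\<close> by (meson order_trans)
  with \<open>l \<noteq> l'\<close> show False
    by simp
qed

section \<open>The tree of functionals over a space without \<open>l1\<close>\<close>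

lemma (in banach_space_over) convex_dual: "convex (dual smul)"
  unfolding convex_def dual_def
  by (auto simp: blinfun.add_left blinfun.scaleR_left scaleR_conv_of_real algebra_simps)

lemma (in banach_space_over) dual_dominated:
  assumes "f \<in> dual smul" "norm f \<le> 1"
  shows "norm (\<Sum>i\<in>F. a i * f (x i)) \<le> norm (\<Sum>i\<in>F. smul (a i) (x i))"
proof -
  have "f (smul c y) = c * f y" for c y
    using assms(1) by (simp add: dual_def)
  then have "(\<Sum>i\<in>F. a i * f (x i)) = f (\<Sum>i\<in>F. smul (a i) (x i))"
    by (simp add: blinfun.sum_right)
  then show ?thesis
    using norm_blinfun_le[OF assms(2)] by simp
qed

text \<open>Stability makes positive oscillation self-reproducing: every subordinate sequence again
  has oscillation \<open>\<delta>\<close>, so splitting goes on forever with the same gap. The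
  absence of \<open>l1\<close> rules this out, and zero oscillation means pointwise
  convergence.\<close>

theorem (in banach_space_over) pointwise_convergent_subord:
  fixes f :: "nat \<Rightarrow> 'x \<Rightarrow>\<^sub>L 'k"
  assumes no: "\<not> contains_l1 smul"
    and f: "\<And>n. f n \<in> dual smul" "\<And>n. norm (f n) \<le> 1"
  obtains g where "subord g f" "\<And>x. convergent (\<lambda>n. g n x)"
proof -
  obtain g where gf: "subord g f" and stab: "\<And>h. subord h g \<Longrightarrow> osc h = osc g"
    by (rule osc_stabilise[of f, OF f(2)]) blast
  have g1: "norm (g n) \<le> 1" for n
    using subord_norm_le[OF gf f(2)] .
  define \<delta> where "\<delta> = osc g"
  have "\<not> \<delta> > 0"
  proof
    assume "\<delta> > 0"
    \<comment> \<open>Iterating \<open>osc_split\<close> gives a dyadic tree of subordinate sequences, indexed by lists in reverse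
      order, and vectors \<open>x n\<close> that separate the two children of every node at level \<open>n\<close>. Along every
      subsequence of \<open>x\<close> some branch oscillates, which contradicts Rosenthal's theorem.\<close>
    define A where "A n H \<longleftrightarrow> (\<forall>\<sigma>. length \<sigma> = n \<longrightarrow> subord (H \<sigma>) g)"
      for n and H :: "bool list \<Rightarrow> nat \<Rightarrow> 'x \<Rightarrow>\<^sub>L 'k"
    define Q where "Q n H H' \<longleftrightarrow> (\<exists>x l. norm x \<le> 1 \<and> (\<forall>\<sigma>. length \<sigma> = n \<longrightarrow>
        (\<forall>b. subord (H' (b # \<sigma>)) (H \<sigma>) \<and> (\<lambda>j. H' (b # \<sigma>) j x) \<longlonglongrightarrow> l \<sigma> b) \<and>
        norm (l \<sigma> True - l \<sigma> False) \<ge> \<delta> / 2))"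
      for n and H H' :: "bool list \<Rightarrow> nat \<Rightarrow> 'x \<Rightarrow>\<^sub>L 'k"
    have "\<exists>H. \<forall>n. A n (H n) \<and> Q n (H n) (H (Suc n))"
    proof (rule dependent_nat_choice[of A Q])
      show "\<exists>H. A 0 H"
        using subord_refl[of g] by (auto simp: A_def intro!: exI[of _ "\<lambda>_. g"])
      fix H n assume "A n H"
      define I where "I = {\<sigma> :: bool list. length \<sigma> = n}"
      have fin: "finite I"
        using finite_lists_length_eq[of "UNIV :: bool set" n] by (simp add: I_def)
      have "replicate n True \<in> I"
        by (simp add: I_def)
      then have ne: "I \<noteq> {}"
        by blast
      have H: "subord (H \<sigma>) g" if "\<sigma> \<in> I" for \<sigma>
        using \<open>A n H\<close> that by (simp add: A_def I_def)
      have st: "osc h = \<delta>" if "subord h g" for h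
        using stab that by (simp add: \<delta>_def)
      obtain x u v a b where x: "norm x \<le> 1"
        and uv: "\<And>i. i \<in> I \<Longrightarrow> subord (u i) (H i)" "\<And>i. i \<in> I \<Longrightarrow> subord (v i) (H i)"
        and ab: "\<And>i. i \<in> I \<Longrightarrow> (\<lambda>n. u i n x) \<longlonglongrightarrow> b i" "\<And>i. i \<in> I \<Longrightarrow> (\<lambda>n. v i n x) \<longlonglongrightarrow> a i"
          "\<And>i. i \<in> I \<Longrightarrow> norm (b i - a i) \<ge> \<delta> / 2"
        by (rule osc_split[of g \<delta> I H, OF g1 st \<open>\<delta> > 0\<close> fin ne H]) blast+
      define H' where "H' \<tau> = (if hd \<tau> then u (tl \<tau>) else v (tl \<tau>))" for \<tau>
      have "A (Suc n) H'"
        unfolding A_def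
      proof (intro allI impI)
        fix \<tau> :: "bool list" assume "length \<tau> = Suc n"
        then have "tl \<tau> \<in> I"
          by (simp add: I_def)
        then show "subord (H' \<tau>) g"
          using subord_trans[OF uv(1) H] subord_trans[OF uv(2) H] by (simp add: H'_def)
      qed
      moreover have "Q n H H'"
        unfolding Q_def
      proof (intro exI[of _ x] exI[of _ "\<lambda>\<sigma> c. if c then b \<sigma> else a \<sigma>"] conjI allI impI x)
        fix \<sigma> :: "bool list" and c :: bool assume "length \<sigma> = n"
        then have "\<sigma> \<in> I"
          by (simp add: I_def)
        then show "subord (H' (c # \<sigma>)) (H \<sigma>)"
          and "(\<lambda>j. H' (c # \<sigma>) j x) \<longlonglongrightarrow> (if c then b \<sigma> else a \<sigma>)"
          and "\<delta> / 2 \<le> norm ((if True then b \<sigma> else a \<sigma>) - (if False then b \<sigma> else a \<sigma>))"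
          using uv ab by (auto simp: H'_def)
      qed
      ultimately show "\<exists>H'. A (Suc n) H' \<and> Q n H H'"
        by blast
    qed
    then obtain H where H: "\<And>n. A n (H n)" "\<And>n. Q n (H n) (H (Suc n))"
      by metis
    have "\<forall>n. \<exists>p. norm (fst p) \<le> 1 \<and> (\<forall>\<sigma>. length \<sigma> = n \<longrightarrow>
        (\<forall>b. subord (H (Suc n) (b # \<sigma>)) (H n \<sigma>) \<and> (\<lambda>j. H (Suc n) (b # \<sigma>) j (fst p)) \<longlonglongrightarrow> snd p \<sigma> b) \<and>
        norm (snd p \<sigma> True - snd p \<sigma> False) \<ge> \<delta> / 2)"
    proof
      fix n
      show "\<exists>p. norm (fst p) \<le> 1 \<and> (\<forall>\<sigma>. length \<sigma> = n \<longrightarrow>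
        (\<forall>b. subord (H (Suc n) (b # \<sigma>)) (H n \<sigma>) \<and> (\<lambda>j. H (Suc n) (b # \<sigma>) j (fst p)) \<longlonglongrightarrow> snd p \<sigma> b) \<and>
        norm (snd p \<sigma> True - snd p \<sigma> False) \<ge> \<delta> / 2)"
        using H(2)[of n] unfolding Q_def split_paired_Ex fst_conv snd_conv .
    qed
    then obtain p where p: "\<forall>n. norm (fst (p n)) \<le> 1 \<and> (\<forall>\<sigma>. length \<sigma> = n \<longrightarrow>
        (\<forall>b. subord (H (Suc n) (b # \<sigma>)) (H n \<sigma>) \<and> (\<lambda>j. H (Suc n) (b # \<sigma>) j (fst (p n))) \<longlonglongrightarrow> snd (p n) \<sigma> b) \<and>
        norm (snd (p n) \<sigma> True - snd (p n) \<sigma> False) \<ge> \<delta> / 2)"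
      by (rule choice[THEN exE])
    define x where "x n = fst (p n)" for n
    define L where "L n = snd (p n)" for n
    have x1: "norm (x n) \<le> 1" for n
      using p by (simp add: x_def)
    have HS: "subord (H (Suc n) (b # \<sigma>)) (H n \<sigma>)" and HL: "(\<lambda>j. H (Suc n) (b # \<sigma>) j (x n)) \<longlonglongrightarrow> L n \<sigma> b"
      and gap: "norm (L n \<sigma> True - L n \<sigma> False) \<ge> \<delta> / 2" if "length \<sigma> = n" for n \<sigma> b
      using p that by (auto simp: x_def L_def)
    define br where "br \<omega> = rec_nat [] (\<lambda>n l. \<omega> n # l)" for \<omega> :: "nat \<Rightarrow> bool"
    have br: "br \<omega> 0 = []" "br \<omega> (Suc n) = \<omega> n # br \<omega> n" for \<omega> n
      by (simp_all add: br_def)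
    have len: "length (br \<omega> n) = n" for \<omega> n
      by (induction n) (simp_all add: br)
    \<comment> \<open>The value of the branch at \<open>x n\<close>. It is fixed once level
      \<open>n\<close> is passed, since all later nodes of the branch are subordinate and keep the
      limit there. No functional on the whole space is formed.\<close>
    define \<Phi> where "\<Phi> \<omega> n = L n (br \<omega> n) (\<omega> n)" for \<omega> n
    have chain: "subord (H m (br \<omega> m)) (H n (br \<omega> n))" if "n \<le> m" for m n \<omega>
      using that
    proof (induction m rule: dec_induct)
      case (step m)
      then show ?case
        using subord_trans[OF HS[of "br \<omega> m" m "\<omega> m", OF len]] by (simp add: br)
    qed (rule subord_refl)
    have \<Phi>lim: "(\<lambda>j. H m (br \<omega> m) j (x n)) \<longlonglongrightarrow> \<Phi> \<omega> n" if "n < m" for m n \<omega>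
      using subord_limit[OF chain[of "Suc n" m \<omega>]] HL[of "br \<omega> n" n "\<omega> n", OF len] that
      by (simp add: br \<Phi>_def)
    \<comment> \<open>Finitely many indices lie below some level \<open>m\<close>; there the branch
      values are limits of values of genuine functionals from the dual ball.\<close>
    have dom: "norm (\<Sum>i\<in>F. a i * \<Phi> \<omega> i) \<le> norm (\<Sum>i\<in>F. smul (a i) (x i))" if fin: "finite F" for \<omega> F a
    proof -
      obtain m where m: "F \<subseteq> {..<m}"
        using finite_nat_bounded[OF fin] by auto
      have hf: "subord (H m (br \<omega> m)) f"
        using H(1)[of m] len subord_trans[OF _ gf] by (simp add: A_def)
      have "H m (br \<omega> m) j \<in> dual smul" "norm (H m (br \<omega> m) j) \<le> 1" for j
        using subord_in_convex[OF hf convex_dual f(1)] subord_norm_le[OF hf f(2)] by auto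
      then have "norm (\<Sum>i\<in>F. a i * H m (br \<omega> m) j (x i)) \<le> norm (\<Sum>i\<in>F. smul (a i) (x i))" for j
        by (rule dual_dominated)
      moreover have "(\<lambda>j. norm (\<Sum>i\<in>F. a i * H m (br \<omega> m) j (x i))) \<longlonglongrightarrow> norm (\<Sum>i\<in>F. a i * \<Phi> \<omega> i)"
        using m by (intro tendsto_norm tendsto_sum tendsto_mult tendsto_const \<Phi>lim) auto
      ultimately show ?thesis
        by (intro LIMSEQ_le_const2) auto
    qed
    obtain r where r: "strict_mono (r :: nat \<Rightarrow> nat)" "\<And>\<omega>. convergent (\<Phi> \<omega> \<circ> r)"
      by (rule rosenthal[of x UNIV \<Phi>, OF no x1 dom]) blast+
    \<comment> \<open>The last branch value that a node determines. The head of the reversed list is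
      the latest decision, so the node \<open>br \<omega> (Suc n)\<close> yields
      \<open>\<Phi> \<omega> n\<close>.\<close>
    define V where "V \<tau> = L (length \<tau> - 1) (tl \<tau>) (hd \<tau>)" for \<tau>
    have V: "V (br \<omega> (Suc n)) = \<Phi> \<omega> n" for \<omega> n
      by (simp add: V_def br len \<Phi>_def)
    \<comment> \<open>At level \<open>r (Suc k)\<close> the value at \<open>r k\<close> is already
      decided by an ancestor, obtained by dropping recent decisions. The limits of the two children
      are at least \<open>\<delta> / 2\<close> apart, so one of them is at least
      \<open>\<delta> / 4\<close> away from that value.\<close>
    have ex: "\<exists>b. \<forall>k. r (Suc k) = length \<sigma> \<longrightarrow>
        norm (L (length \<sigma>) \<sigma> b - V (drop (length \<sigma> - Suc (r k)) \<sigma>)) \<ge> \<delta> / 4" for \<sigma>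
    proof (cases "\<exists>k. r (Suc k) = length \<sigma>")
      case True
      then obtain k where k: "r (Suc k) = length \<sigma>"
        by blast
      define w where "w = V (drop (length \<sigma> - Suc (r k)) \<sigma>)"
      have "norm (L (length \<sigma>) \<sigma> True - L (length \<sigma>) \<sigma> False)
          \<le> norm (L (length \<sigma>) \<sigma> True - w) + norm (L (length \<sigma>) \<sigma> False - w)"
        using norm_triangle_ineq4[of "L (length \<sigma>) \<sigma> True - w" "L (length \<sigma>) \<sigma> False - w"] by simp
      then have "norm (L (length \<sigma>) \<sigma> True - w) \<ge> \<delta> / 4 \<or> norm (L (length \<sigma>) \<sigma> False - w) \<ge> \<delta> / 4"
        using gap[of \<sigma> "length \<sigma>"] by simp linarith
      then obtain b where b: "norm (L (length \<sigma>) \<sigma> b - w) \<ge> \<delta> / 4"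
        by blast
      have "j = k" if "r (Suc j) = length \<sigma>" for j
        using strict_mono_eq[OF r(1), of "Suc j" "Suc k"] that k by simp
      with b show ?thesis
        unfolding w_def by blast
    qed blast
    define pick where "pick \<sigma> = (SOME b. \<forall>k. r (Suc k) = length \<sigma> \<longrightarrow>
        norm (L (length \<sigma>) \<sigma> b - V (drop (length \<sigma> - Suc (r k)) \<sigma>)) \<ge> \<delta> / 4)" for \<sigma>
    have pick: "norm (L (length \<sigma>) \<sigma> (pick \<sigma>) - V (drop (length \<sigma> - Suc (r k)) \<sigma>)) \<ge> \<delta> / 4"
      if "r (Suc k) = length \<sigma>" for \<sigma> k
      using someI_ex[OF ex[of \<sigma>]] that unfolding pick_def by blast
    \<comment> \<open>The branch that follows \<open>pick\<close> at each of its own nodes; between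
      the levels in the range of \<open>r\<close> the choice is arbitrary.\<close>
    define pl where "pl = rec_nat [] (\<lambda>n l. pick l # l)"
    define \<omega> where "\<omega> n = pick (pl n)" for n
    have pl: "br \<omega> n = pl n" for n
      by (induction n) (simp_all add: br pl_def \<omega>_def)
    have drop: "drop (n - i) (br \<omega> n) = br \<omega> i" if "i \<le> n" for n i
      using that by (induction n rule: dec_induct) (simp_all add: br Suc_diff_le)
    have far: "norm (\<Phi> \<omega> (r (Suc k)) - \<Phi> \<omega> (r k)) \<ge> \<delta> / 4" for k
    proof -
      have "Suc (r k) \<le> r (Suc k)"
        using r(1) by (simp add: strict_mono_def Suc_leI)
      then have "V (drop (r (Suc k) - Suc (r k)) (br \<omega> (r (Suc k)))) = \<Phi> \<omega> (r k)"
        by (simp only: drop V)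
      moreover have "\<Phi> \<omega> (r (Suc k)) = L (r (Suc k)) (br \<omega> (r (Suc k))) (pick (br \<omega> (r (Suc k))))"
        by (simp add: \<Phi>_def \<omega>_def pl)
      ultimately show ?thesis
        using pick[of k "br \<omega> (r (Suc k))"] by (simp add: len)
    qed
    have "Cauchy (\<Phi> \<omega> \<circ> r)"
      using r(2) by (rule convergent_Cauchy)
    then obtain K where "\<And>m n. m \<ge> K \<Longrightarrow> n \<ge> K \<Longrightarrow> norm (\<Phi> \<omega> (r m) - \<Phi> \<omega> (r n)) < \<delta> / 4"
      using CauchyD[of "\<Phi> \<omega> \<circ> r" "\<delta> / 4"] \<open>\<delta> > 0\<close> by auto
    from this[of "Suc K" K] far[of K] show False
      by simp
  qed
  then have "osc g \<le> 0"
    by (simp add: \<delta>_def)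
  then show ?thesis
    using that[OF gf] osc_zero_convergent[of g, OF g1] by blast
qed

subsection \<open>The inequalities\<close>

lemma limitin_topology_generated_by:
  assumes "l \<in> \<Union>\<S>" and basis: "\<And>U. U \<in> \<S> \<Longrightarrow> l \<in> U \<Longrightarrow> eventually (\<lambda>a. f a \<in> U) F"
  shows "limitin (topology_generated_by \<S>) f l F"
  unfolding limitin_def
proof (intro conjI allI impI)
  show "l \<in> topspace (topology_generated_by \<S>)"
    using assms(1) by simp
  fix U assume "openin (topology_generated_by \<S>) U \<and> l \<in> U"
  then have "generate_topology_on \<S> U" "l \<in> U"
    by (auto simp: openin_topology_generated_by_iff)
  then show "eventually (\<lambda>a. f a \<in> U) F"
  proof (induction rule: generate_topology_on.induct)
    case (Int a b)
    then show ?case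
      by (simp add: eventually_conj)
  next
    case (UN K)
    then obtain k where k: "k \<in> K" "l \<in> k"
      by blast
    with UN have "eventually (\<lambda>a. f a \<in> k) F"
      by blast
    then show ?case
      by (rule eventually_mono) (use k in blast)
  qed (use basis in auto)
qed

lemma limitin_strong_operator_topology:
  "limitin strong_operator_topology f l F \<longleftrightarrow> (\<forall>x. ((\<lambda>a. blinfun_apply (f a) x) \<longlongrightarrow> l x) F)"
proof
  assume "limitin strong_operator_topology f l F"
  then show "\<forall>x. ((\<lambda>a. blinfun_apply (f a) x) \<longlongrightarrow> l x) F"
    using continuous_map_limit[OF strong_operator_topology_continuous_evaluation]
    by (fastforce simp: o_def)
next
  assume *: "\<forall>x. ((\<lambda>a. blinfun_apply (f a) x) \<longlongrightarrow> l x) F"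
  have "limitin euclidean (\<lambda>a. blinfun_apply (f a)) (blinfun_apply l) F"
    unfolding euclidean_product_topology[symmetric] limitin_componentwise
    using * by simp
  then have lim: "((\<lambda>a. blinfun_apply (f a)) \<longlongrightarrow> blinfun_apply l) F"
    by simp
  show "limitin strong_operator_topology f l F"
    unfolding limitin_def strong_operator_topology_topspace
  proof (intro conjI allI impI UNIV_I)
    fix U assume U: "openin strong_operator_topology U \<and> l \<in> U"
    then obtain V where V: "open V" "U = blinfun_apply -` V"
      by (auto simp: strong_operator_topology_def openin_pullback_topology)
    have "eventually (\<lambda>a. blinfun_apply (f a) \<in> V) F"
      using topological_tendstoD[OF lim V(1)] U V(2) by simp
    then show "eventually (\<lambda>a. f a \<in> U) F"
      by (simp add: V(2))
  qed
qed

context banach_space_over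
begin

lemma zero_in_dual: "0 \<in> dual smul"
  by (simp add: dual_def zero_blinfun.rep_eq)

lemma weakly_null_seqsI:
  assumes "\<And>n. norm (x n) \<le> 1" "\<And>f. f \<in> dual smul \<Longrightarrow> (\<lambda>n. blinfun_apply f (x n)) \<longlonglongrightarrow> 0"
  shows "x \<in> weakly_null_seqs smul"
proof -
  have "limitin (weak_topology smul) x 0 sequentially"
    unfolding weak_topology_def
  proof (rule limitin_topology_generated_by)
    show "0 \<in> \<Union> {blinfun_apply f -` U |f U. f \<in> dual smul \<and> open U}"
      using zero_in_dual open_UNIV by blast
    fix W assume "W \<in> {blinfun_apply f -` U |f U. f \<in> dual smul \<and> open U}" "0 \<in> W"
    then obtain f U where W: "W = blinfun_apply f -` U" "f \<in> dual smul" "open U" "0 \<in> U"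
      by (auto simp: blinfun.zero_right)
    show "\<forall>\<^sub>F n in sequentially. x n \<in> W"
      using topological_tendstoD[OF assms(2)[OF W(2)] W(3,4)] by (simp add: W(1))
  qed
  then show ?thesis
    using assms(1) by (simp add: weakly_null_seqs_def)
qed

lemma weak_star_null_seqs_iff:
  "f \<in> weak_star_null_seqs smul \<longleftrightarrow>
    (\<forall>n. f n \<in> dual smul) \<and> (\<forall>n. norm (f n) \<le> 1) \<and> (\<forall>x. (\<lambda>n. blinfun_apply (f n) x) \<longlonglongrightarrow> 0)"
  unfolding weak_star_null_seqs_def weak_star_topology_def limitin_subtopology
    limitin_strong_operator_topology
  by (auto simp: zero_in_dual zero_blinfun.rep_eq)

lemma K1_le_G: "K1 smul \<le> G smul"
proof -
  have "alpha smul g \<le> limsup (\<lambda>n. ereal (norm (g n)))" for g :: "nat \<Rightarrow> 'x \<Rightarrow>\<^sub>L 'k"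
    unfolding alpha_def
  proof (rule SUP_least)
    fix K assume "K \<in> weakly_compact_sets smul"
    then have K: "norm x \<le> 1" if "x \<in> K" for x
      using that by (auto simp: weakly_compact_sets_def)
    have "(SUP x\<in>K. ereal (norm (blinfun_apply (g n) x))) \<le> ereal (norm (g n))" for n
    proof (rule SUP_least)
      fix x assume "x \<in> K"
      then show "ereal (norm (blinfun_apply (g n) x)) \<le> ereal (norm (g n))"
        using norm_blinfun[of "g n" x] mult_left_le[OF K, of x "norm (g n)"] by simp
    qed
    then show "limsup (\<lambda>n. SUP x\<in>K. ereal (norm (blinfun_apply (g n) x))) \<le> limsup (\<lambda>n. ereal (norm (g n)))"
      by (intro Limsup_mono always_eventually) simp
  qed
  then show ?thesis
    unfolding K1_def G_def by (intro SUP_mono' INF_mono') simp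
qed

end

section \<open>Convex blocks against subordinate sequences, and \<open>G\<close> against
  \<open>R\<close>\<close>

lemma subord_if_cbs:
  assumes "y \<in> cbs x"
  shows "subord y x"
proof -
  obtain k where k: "strict_mono k" "\<And>n. y n \<in> convex hull (x ` {k n..<k (Suc n)})"
    using assms by (auto simp: cbs_def)
  have "y n \<in> convex hull (x ` {n..})" for n
  proof -
    have "x ` {k n..<k (Suc n)} \<subseteq> x ` {n..}"
      using seq_suble[OF k(1), of n] by auto
    then show ?thesis
      using k(2)[of n] hull_mono by blast
  qed
  then show ?thesis
    by (simp add: subord_def)
qed

text \<open>Each \<open>y i\<close> uses only terms of \<open>x\<close> from \<open>i\<close> to
  below some \<open>M i\<close>. Iterating \<open>M\<close> from 0 yields indices that serve both as
  the selected terms and as the block endpoints, so the overlaps disappear.\<close>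

lemma subord_imp_subseq_cbs:
  assumes "subord y x"
  obtains k where "strict_mono (k :: nat \<Rightarrow> nat)" "y \<circ> k \<in> cbs x"
proof -
  have "\<exists>m>i. y i \<in> convex hull (x ` {i..<m})" for i
  proof -
    obtain T w where T: "finite T" "T \<subseteq> {i..}" "\<And>t. t \<in> T \<Longrightarrow> 0 \<le> w t" "sum w T = 1"
        "y i = (\<Sum>t\<in>T. w t *\<^sub>R x t)"
      using assms convex_hull_imageE[of "y i" x "{i..}"] unfolding subord_def by metis
    obtain m where m: "T \<subseteq> {..<m}"
      using finite_nat_bounded[OF T(1)] by blast
    have "x t \<in> convex hull (x ` {i..<max m (Suc i)})" if "t \<in> T" for t
      using that T(2) m by (intro hull_inc imageI) force
    then have "y i \<in> convex hull (x ` {i..<max m (Suc i)})"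
      unfolding T(5) using T by (intro convex_sum) auto
    then show ?thesis
      by (intro exI[of _ "max m (Suc i)"]) simp
  qed
  then obtain M where M: "\<And>i. i < M i" "\<And>i. y i \<in> convex hull (x ` {i..<M i})"
    by metis
  define k where "k = rec_nat 0 (\<lambda>_. M)"
  have k: "k 0 = 0" "k (Suc n) = M (k n)" for n
    by (simp_all add: k_def)
  have "strict_mono k"
    using M(1) by (simp add: strict_mono_Suc_iff k)
  moreover have "(y \<circ> k) n \<in> convex hull (x ` {k n..<k (Suc n)})" for n
    using M(2) by (simp add: k)
  ultimately show ?thesis
    using that k(1) unfolding cbs_def by blast
qed

text \<open>Weak* lower semicontinuity of the norm: \<open>g k - g l\<close> tends pointwise to
  \<open>g k\<close> as \<open>l\<close> grows.\<close>

lemma ereal_norm_le_if_limit_diff: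
  fixes g :: "nat \<Rightarrow> 'x::real_normed_vector \<Rightarrow>\<^sub>L 'k::real_normed_vector"
  assumes null: "\<And>x. (\<lambda>n. g n x) \<longlonglongrightarrow> 0"
    and le: "\<And>l. l \<ge> n \<Longrightarrow> ereal (norm (g k - g l)) \<le> S"
  shows "ereal (norm (g k)) \<le> S"
proof (cases S)
  case (real s)
  then have s: "norm (g k - g l) \<le> s" if "l \<ge> n" for l
    using le[OF that] by simp
  have "norm (g k x) \<le> s * norm x" for x
  proof (rule LIMSEQ_le_const2)
    have "(\<lambda>l. g k x - g l x) \<longlonglongrightarrow> g k x - 0"
      by (intro tendsto_intros null)
    then show "(\<lambda>l. norm ((g k - g l) x)) \<longlonglongrightarrow> norm (g k x)"
      by (simp add: blinfun.diff_left tendsto_norm)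
    show "\<exists>N. \<forall>l\<ge>N. norm ((g k - g l) x) \<le> s * norm x"
      using s norm_blinfun[of "g k - g _" x] mult_right_mono[OF s norm_ge_zero[of x]]
      by (meson order_trans)
  qed
  moreover have "0 \<le> s"
    using s[of n] norm_ge_zero order_trans by blast
  ultimately show ?thesis
    using real by (simp add: norm_blinfun_bound)
qed (use le[of n] in auto)

lemma limsup_norm_le_ca:
  fixes g :: "nat \<Rightarrow> 'x::real_normed_vector \<Rightarrow>\<^sub>L 'k::real_normed_vector"
  assumes null: "\<And>x. (\<lambda>n. g n x) \<longlonglongrightarrow> 0"
  shows "limsup (\<lambda>n. ereal (norm (g n))) \<le> ca g"
  unfolding ca_def
proof (rule INF_greatest)
  fix n
  define S where "S = (SUP (k, l)\<in>{n..} \<times> {n..}. ereal (norm (g k - g l)))"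
  have "ereal (norm (g k)) \<le> S" if "k \<ge> n" for k
  proof (rule ereal_norm_le_if_limit_diff[OF null])
    fix l assume "l \<ge> n"
    then show "ereal (norm (g k - g l)) \<le> S"
      unfolding S_def using that by (intro SUP_upper2[of "(k, l)"]) auto
  qed
  then show "limsup (\<lambda>n. ereal (norm (g n))) \<le> S"
    by (intro Limsup_bounded eventually_sequentiallyI[of n])
qed

lemma (in banach_space_over) G_le_R: "G smul \<le> R (dual smul)"
  unfolding G_def
proof (rule SUP_least)
  fix f assume "f \<in> weak_star_null_seqs smul"
  then have f: "\<And>n. f n \<in> dual smul" "\<And>n. norm (f n) \<le> 1" "\<And>x. (\<lambda>n. blinfun_apply (f n) x) \<longlonglongrightarrow> 0"
    by (auto simp: weak_star_null_seqs_iff)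
  have "(INF g\<in>cbs f. limsup (\<lambda>n. ereal (norm (g n)))) \<le> (INF g\<in>cbs f. ca g)"
  proof (rule INF_mono)
    fix g assume g: "g \<in> cbs f"
    have "limsup (\<lambda>n. ereal (norm (g n))) \<le> ca g"
      by (rule limsup_norm_le_ca[OF subord_limit[OF subord_if_cbs[OF g] f(3)]])
    with g show "\<exists>g'\<in>cbs f. limsup (\<lambda>n. ereal (norm (g' n))) \<le> ca g"
      by blast
  qed
  also have "\<dots> \<le> R (dual smul)"
    unfolding R_def using f by (intro SUP_upper) auto
  finally show "(INF g\<in>cbs f. limsup (\<lambda>n. ereal (norm (g n)))) \<le> R (dual smul)" .
qed

section \<open>Norms of weak* null sequences against \<open>beta\<close>, and \<open>R\<close>
  against \<open>K2\<close>\<close>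

lemma exists_norming_vector:
  fixes f :: "'x::real_normed_vector \<Rightarrow>\<^sub>L 'k::real_normed_vector"
  assumes "0 \<le> r" "r < norm f"
  obtains x where "norm x \<le> 1" "r < norm (f x)"
proof -
  have "\<exists>x. norm x \<le> 1 \<and> r < norm (f x)"
  proof (rule ccontr)
    assume no: "\<not> ?thesis"
    have "norm (f x) \<le> r * norm x" for x
    proof (cases "x = 0")
      case False
      define y where "y = (1 / norm x) *\<^sub>R x"
      have "norm (f y) \<le> r"
        using no False by (auto simp: y_def not_less)
      then show ?thesis
        using False by (simp add: y_def blinfun.scaleR_right field_simps)
    qed (simp add: blinfun.zero_right)
    then have "norm f \<le> r"
      using assms(1) by (rule norm_blinfun_bound[rotated])
    with assms(2) show False
      by simp
  qed
  then show ?thesis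
    using that by blast
qed

context banach_space_over
begin

lemma weakly_Cauchy_subseq:
  assumes no: "\<not> contains_l1 smul" and x: "\<And>n. norm (x n) \<le> 1"
  obtains r where "strict_mono (r :: nat \<Rightarrow> nat)"
    "\<And>f. f \<in> dual smul \<Longrightarrow> convergent (\<lambda>n. blinfun_apply f (x (r n)))"
proof -
  obtain r where r: "strict_mono (r :: nat \<Rightarrow> nat)"
      "\<And>f. f \<in> {f \<in> dual smul. norm f \<le> 1} \<Longrightarrow> convergent ((\<lambda>n. blinfun_apply f (x n)) \<circ> r)"
    by (rule rosenthal[of x "{f \<in> dual smul. norm f \<le> 1}" "\<lambda>f n. blinfun_apply f (x n)", OF no x])
      (use dual_dominated in auto)
  have "convergent (\<lambda>n. blinfun_apply f (x (r n)))" if f: "f \<in> dual smul" for f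
  proof -
    define c where "c = norm f + 1"
    have c: "c > 0" "norm f \<le> c"
      by (simp_all add: c_def add_nonneg_pos)
    have "(1 / c) *\<^sub>R f \<in> dual smul"
      using f by (simp add: dual_def blinfun.scaleR_left)
    moreover have "norm ((1 / c) *\<^sub>R f) \<le> 1"
      using c by simp
    ultimately have "convergent (\<lambda>n. ((1 / c) *\<^sub>R f) (x (r n)))"
      using r(2)[of "(1 / c) *\<^sub>R f"] by (simp add: o_def)
    then obtain l where "(\<lambda>n. ((1 / c) *\<^sub>R f) (x (r n))) \<longlonglongrightarrow> l"
      by (auto simp: convergent_def)
    then have "(\<lambda>n. c *\<^sub>R ((1 / c) *\<^sub>R f) (x (r n))) \<longlonglongrightarrow> c *\<^sub>R l"
      by (rule tendsto_scaleR[OF tendsto_const])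
    then show ?thesis
      using c(1) by (auto simp: convergent_def blinfun.scaleR_left)
  qed
  with r(1) show ?thesis
    by (rule that)
qed

text \<open>\<open>beta\<close> pairs the functional and the vector of equal index, so the
  half-differences are placed at the positions \<open>s k\<close> of the functionals meant for them,
  with zeros in between. The half keeps them in the unit ball.\<close>

lemma weakly_null_differences:
  assumes X: "\<And>n. norm (X n) \<le> 1"
    and Cau: "\<And>f. f \<in> dual smul \<Longrightarrow> convergent (\<lambda>n. blinfun_apply f (X n))"
    and s: "strict_mono (s :: nat \<Rightarrow> nat)"
  obtains y where "y \<in> weakly_null_seqs smul" "\<And>k. y (s k) = (1 / 2) *\<^sub>R (X (Suc k) - X k)"
proof -
  define y where "y m = (if m \<in> range s then (1 / 2) *\<^sub>R (X (Suc (inv s m)) - X (inv s m)) else 0)" for m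
  have inv: "inv s (s k) = k" for k
    using s by (simp add: strict_mono_imp_inj_on)
  have y: "y (s k) = (1 / 2) *\<^sub>R (X (Suc k) - X k)" for k
    by (simp add: y_def inv)
  have "y \<in> weakly_null_seqs smul"
  proof (rule weakly_null_seqsI)
    fix m
    have "norm (X (Suc k) - X k) \<le> 2" for k
      using norm_triangle_ineq4[of "X (Suc k)" "X k"] X[of k] X[of "Suc k"] by simp
    then show "norm (y m) \<le> 1"
      by (simp add: y_def)
  next
    fix f assume f: "f \<in> dual smul"
    show "(\<lambda>m. blinfun_apply f (y m)) \<longlonglongrightarrow> 0"
    proof (rule LIMSEQ_I)
      fix e :: real assume "e > 0"
      obtain K where K: "\<And>i j. i \<ge> K \<Longrightarrow> j \<ge> K \<Longrightarrow> norm (f (X i) - f (X j)) < e"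
        using CauchyD[OF convergent_Cauchy[OF Cau[OF f]] \<open>e > 0\<close>] by auto
      have "norm (blinfun_apply f (y m) - 0) < e" if "m \<ge> s K" for m
      proof (cases "m \<in> range s")
        case True
        then obtain k where k: "m = s k"
          by blast
        have "k \<ge> K"
          using that strict_mono_less_eq[OF s] by (simp add: k)
        then have "norm (f (X (Suc k)) - f (X k)) < e"
          using K by simp
        then show ?thesis
          using norm_ge_zero[of "f (X (Suc k)) - f (X k)"]
          by (simp add: k y blinfun.scaleR_right blinfun.diff_right del: norm_ge_zero)
      qed (simp add: y_def blinfun.zero_right \<open>e > 0\<close>)
      then show "\<exists>N. \<forall>m\<ge>N. norm (blinfun_apply f (y m) - 0) < e"
        by blast
    qed
  qed
  then show ?thesis
    using y by (rule that)
qed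

text \<open>A gliding hump: a norming vector is held fixed, and a functional far enough along the
  weak* null sequence nearly vanishes on it while exceeding \<open>r\<close> on its own norming
  vector. The difference of the two vectors thus still gives almost \<open>r\<close>.\<close>

lemma half_le_beta:
  assumes no: "\<not> contains_l1 smul"
    and null: "\<And>x. (\<lambda>n. blinfun_apply (p n) x) \<longlonglongrightarrow> 0"
    and "0 \<le> r" and large: "infinite {n. r < norm (p n)}"
  shows "ereal (r / 2) \<le> beta smul p"
proof -
  define s0 where "s0 = enumerate {n. r < norm (p n)}"
  have s0: "strict_mono s0" "r < norm (p (s0 n))" for n
    using large enumerate_in_set[OF large, of n] by (auto simp: s0_def strict_mono_enumerate)
  have "\<exists>x. norm x \<le> 1 \<and> r < norm (p (s0 n) x)" for n
    using exists_norming_vector[OF \<open>0 \<le> r\<close> s0(2)[of n]] by blast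
  then obtain x0 where x0: "\<And>n. norm (x0 n) \<le> 1" "\<And>n. r < norm (p (s0 n) (x0 n))"
    by metis
  obtain t where t: "strict_mono (t :: nat \<Rightarrow> nat)"
      "\<And>f. f \<in> dual smul \<Longrightarrow> convergent (\<lambda>n. blinfun_apply f (x0 (t n)))"
    using weakly_Cauchy_subseq[of x0, OF no x0(1)] by blast
  have st: "strict_mono (s0 \<circ> t)"
    using s0(1) t(1) by (rule strict_mono_o)
  define Q where "Q k a b \<longleftrightarrow> a < b \<and> norm (p (s0 (t b)) (x0 (t a))) < 1 / real (Suc k)" for k a b
  have "\<exists>u :: nat \<Rightarrow> nat. \<forall>k. True \<and> Q k (u k) (u (Suc k))"
  proof (rule dependent_nat_choice[of "\<lambda>_ _. True" Q])
    fix a k :: nat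
    have "(\<lambda>b. p ((s0 \<circ> t) b) (x0 (t a))) \<longlonglongrightarrow> 0"
      using LIMSEQ_subseq_LIMSEQ[OF null st] by (simp add: o_def)
    then have "\<exists>N. \<forall>b\<ge>N. norm (p ((s0 \<circ> t) b) (x0 (t a)) - 0) < 1 / real (Suc k)"
      by (rule LIMSEQ_D) simp
    then obtain N where N: "\<forall>b\<ge>N. norm (p ((s0 \<circ> t) b) (x0 (t a)) - 0) < 1 / real (Suc k)"
      by blast
    have "Q k a (max N (Suc a))"
      using N[rule_format, of "max N (Suc a)"] by (simp add: Q_def)
    then show "\<exists>b. True \<and> Q k a b"
      by blast
  qed simp
  then obtain u where u: "\<And>k. Q k (u k) (u (Suc k))"
    by blast
  have um: "strict_mono u"
    using u by (simp add: strict_mono_Suc_iff Q_def)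
  \<comment> \<open>The shift by one matters: the functional at \<open>s k\<close> is large on
    \<open>X (Suc k)\<close>, which it norms, and by the choice of \<open>u\<close> smaller than
    \<open>1 / real (Suc k)\<close> on \<open>X k\<close>.\<close>
  define s where "s k = s0 (t (u (Suc k)))" for k
  define X where "X k = x0 (t (u k))" for k
  have s: "strict_mono s"
    using strict_mono_o[OF st um] by (simp add: s_def strict_mono_def)
  have "convergent (\<lambda>n. blinfun_apply f (X n))" if "f \<in> dual smul" for f
    using convergent_subseq_convergent[OF t(2)[OF that] um] by (simp add: X_def o_def)
  then obtain y where y: "y \<in> weakly_null_seqs smul" "\<And>k. y (s k) = (1 / 2) *\<^sub>R (X (Suc k) - X k)"
    using weakly_null_differences[of X s] x0(1) s by (metis X_def)
  have lower: "(r - 1 / real (Suc k)) / 2 \<le> norm (p (s k) (y (s k)))" for k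
  proof -
    have "r < norm (p (s k) (X (Suc k)))"
      using x0(2)[of "t (u (Suc k))"] by (simp add: s_def X_def)
    moreover have "norm (p (s k) (X k)) < 1 / real (Suc k)"
      using u[of k] by (simp add: Q_def s_def X_def)
    ultimately have "r - 1 / real (Suc k) \<le> norm (p (s k) (X (Suc k)) - p (s k) (X k))"
      using norm_triangle_ineq2[of "p (s k) (X (Suc k))" "p (s k) (X k)"] by linarith
    then show ?thesis
      by (simp add: y(2) blinfun.scaleR_right blinfun.diff_right)
  qed
  have "(\<lambda>k. (r - 1 / real (Suc k)) / 2) \<longlonglongrightarrow> (r - 0) / 2"
    by (intro tendsto_intros LIMSEQ_Suc[OF lim_1_over_n]) simp
  then have "ereal (r / 2) = limsup (\<lambda>k. ereal ((r - 1 / real (Suc k)) / 2))"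
    using lim_imp_Limsup[of sequentially "\<lambda>k. ereal ((r - 1 / real (Suc k)) / 2)" "ereal (r / 2)"] by simp
  also have "\<dots> \<le> limsup ((\<lambda>n. ereal (norm (p n (y n)))) \<circ> s)"
    using lower by (intro Limsup_mono always_eventually) simp
  also have "\<dots> \<le> limsup (\<lambda>n. ereal (norm (p n (y n))))"
    using s by (rule limsup_subseq_mono)
  also have "\<dots> \<le> beta smul p"
    unfolding beta_def using y(1) by (rule SUP_upper)
  finally show ?thesis .
qed

lemma limsup_norm_le_beta:
  assumes "\<not> contains_l1 smul" and "\<And>x. (\<lambda>n. blinfun_apply (p n) x) \<longlonglongrightarrow> 0"
  shows "limsup (\<lambda>n. ereal (norm (p n))) \<le> 2 * beta smul p"
proof (rule dense_le)
  fix c :: ereal assume c: "c < limsup (\<lambda>n. ereal (norm (p n)))"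
  \<comment> \<open>The zero sequence makes \<open>beta\<close> nonnegative, which settles the
    bounds \<open>c\<close> that are not positive.\<close>
  have "(\<lambda>_. 0) \<in> weakly_null_seqs smul"
    by (rule weakly_null_seqsI) (simp_all add: blinfun.zero_right)
  then have "limsup (\<lambda>n. ereal (norm (p n 0))) \<le> beta smul p"
    unfolding beta_def by (rule SUP_upper2) simp
  then have beta0: "0 \<le> beta smul p"
    by (simp add: blinfun.zero_right Limsup_const flip: zero_ereal_def)
  show "c \<le> 2 * beta smul p"
  proof (cases "c \<le> 0")
    case True
    then show ?thesis
      by (rule order_trans) (use beta0 in simp)
  next
    case False
    with c obtain r where r: "c = ereal r" "r > 0"
      by (cases c) auto
    have "infinite {n. r < norm (p n)}"
    proof
      assume "finite {n. r < norm (p n)}"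
      then have "eventually (\<lambda>n. \<not> r < norm (p n)) sequentially"
        by (simp add: eventually_cofinite flip: cofinite_eq_sequentially)
      then have "eventually (\<lambda>n. ereal (norm (p n)) \<le> c) sequentially"
        by (rule eventually_mono) (simp add: r(1))
      then have "limsup (\<lambda>n. ereal (norm (p n))) \<le> c"
        by (rule Limsup_bounded)
      with c show False
        by simp
    qed
    then have "ereal (r / 2) \<le> beta smul p"
      using half_le_beta[OF assms, of r] r(2) by simp
    then have "2 * ereal (r / 2) \<le> 2 * beta smul p"
      by (rule ereal_mult_left_mono) simp
    then show ?thesis
      by (simp add: r(1))
  qed
qed

lemma pointwise_limit_in_dual:
  assumes g: "\<And>n. g n \<in> dual smul" "\<And>n. norm (g n) \<le> 1"
    and conv: "\<And>x. convergent (\<lambda>n. blinfun_apply (g n) x)"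
  obtains F where "F \<in> dual smul" "norm F \<le> 1" "\<And>x. (\<lambda>n. blinfun_apply (g n) x) \<longlonglongrightarrow> F x"
proof -
  define L where "L x = lim (\<lambda>n. blinfun_apply (g n) x)" for x
  have L: "(\<lambda>n. blinfun_apply (g n) x) \<longlonglongrightarrow> L x" for x
    using conv[of x] by (simp add: L_def convergent_LIMSEQ_iff)
  have le: "norm (L x) \<le> norm x * 1" for x
    using norm_blinfun_le[OF g(2), of _ x] by (intro LIMSEQ_le_const2[OF tendsto_norm[OF L]]) auto
  have uniq: "L z = l" if "(\<lambda>n. blinfun_apply (g n) z) \<longlonglongrightarrow> l" for z l
    using LIMSEQ_unique[OF L that] .
  have "bounded_linear L"
  proof (rule bounded_linear_intro[OF _ _ le])
    show "L (x + y) = L x + L y" for x y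
      by (rule uniq) (simp add: blinfun.add_right tendsto_add L)
    show "L (r *\<^sub>R x) = r *\<^sub>R L x" for r x
      by (rule uniq) (simp add: blinfun.scaleR_right tendsto_scaleR L)
  qed
  then have F: "blinfun_apply (Blinfun L) = L"
    by (rule bounded_linear_Blinfun_apply)
  have "L (smul c x) = c * L x" for c x
  proof (rule uniq)
    have "blinfun_apply (g n) (smul c x) = c * blinfun_apply (g n) x" for n
      using g(1)[of n] by (simp add: dual_def)
    then show "(\<lambda>n. blinfun_apply (g n) (smul c x)) \<longlonglongrightarrow> c * L x"
      by (simp add: tendsto_mult L)
  qed
  then have "Blinfun L \<in> dual smul"
    by (simp add: dual_def F)
  moreover have "norm (Blinfun L) \<le> 1"
    using le by (intro norm_blinfun_bound) (simp_all add: F)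
  ultimately show ?thesis
    using that[of "Blinfun L"] L by (simp add: F)
qed

text \<open>The translation by \<open>a\<close> cancels in differences. One factor 2 of the 4 is the
  scaling of \<open>p\<close>, the other comes from the triangle inequality.\<close>

lemma ca_le_limsup_norm:
  fixes p :: "nat \<Rightarrow> 'v::real_normed_vector"
  assumes k: "strict_mono (k :: nat \<Rightarrow> nat)"
  shows "ca (\<lambda>n. a + 2 *\<^sub>R p (k n)) \<le> 4 * limsup (\<lambda>n. ereal (norm (p n)))"
proof -
  have "ca (\<lambda>n. a + 2 *\<^sub>R p (k n)) / 4 \<le> limsup (\<lambda>n. ereal (norm (p n)))"
  proof (rule dense_ge)
    fix c assume c: "limsup (\<lambda>n. ereal (norm (p n))) < c"
    then have "eventually (\<lambda>n. ereal (norm (p n)) < c) sequentially"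
      by (rule Limsup_lessD)
    then obtain N where N: "\<And>n. n \<ge> N \<Longrightarrow> ereal (norm (p n)) < c"
      by (auto simp: eventually_sequentially)
    have "ereal (norm ((a + 2 *\<^sub>R p (k i)) - (a + 2 *\<^sub>R p (k j)))) \<le> 4 * c" if "i \<ge> N" "j \<ge> N" for i j
    proof (cases c)
      case (real r)
      have "norm (p (k i)) < r" "norm (p (k j)) < r"
        using N[of "k i"] N[of "k j"] seq_suble[OF k, of i] seq_suble[OF k, of j] that real by auto
      moreover have "(a + 2 *\<^sub>R p (k i)) - (a + 2 *\<^sub>R p (k j)) = 2 *\<^sub>R (p (k i) - p (k j))"
        by (simp add: scaleR_diff_right)
      ultimately have "norm ((a + 2 *\<^sub>R p (k i)) - (a + 2 *\<^sub>R p (k j))) \<le> 4 * r"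
        using norm_triangle_ineq4[of "p (k i)" "p (k j)"] by simp
      then show ?thesis
        by (simp add: real)
    next
      case MInf
      then show ?thesis
        using N[of N] by simp
    qed simp
    then have "ca (\<lambda>n. a + 2 *\<^sub>R p (k n)) \<le> 4 * c"
      unfolding ca_def by (intro INF_lower2[of N] SUP_least) auto
    then show "ca (\<lambda>n. a + 2 *\<^sub>R p (k n)) / 4 \<le> c"
      by (subst ereal_divide_le_pos) simp_all
  qed
  then show ?thesis
    by (subst (asm) ereal_divide_le_pos) simp_all
qed

lemma R_le_K2:
  assumes no: "\<not> contains_l1 smul"
  shows "R (dual smul) \<le> 8 * K2 smul"
  unfolding R_def
proof (rule SUP_least)
  fix f :: "nat \<Rightarrow> 'x \<Rightarrow>\<^sub>L 'k" assume "f \<in> {x. \<forall>n. x n \<in> dual smul \<inter> cball 0 1}"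
  then have f: "\<And>n. f n \<in> dual smul" "\<And>n. norm (f n) \<le> 1"
    by auto
  obtain g where gf: "subord g f" and conv: "\<And>x. convergent (\<lambda>n. blinfun_apply (g n) x)"
    by (rule pointwise_convergent_subord[of f, OF no f]) blast
  have g: "\<And>n. g n \<in> dual smul" "\<And>n. norm (g n) \<le> 1"
    using subord_in_convex[OF gf convex_dual f(1)] subord_norm_le[OF gf f(2)] by auto
  obtain F where F: "F \<in> dual smul" "norm F \<le> 1" "\<And>x. (\<lambda>n. blinfun_apply (g n) x) \<longlonglongrightarrow> F x"
    by (rule pointwise_limit_in_dual[of g, OF g conv]) blast
  \<comment> \<open>Both \<open>g n\<close> and \<open>F\<close> have norm at most 1, so the half
    brings the difference into the unit ball.\<close>
  define q where "q n = (1 / 2) *\<^sub>R (g n - F)" for n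
  have q0: "(\<lambda>n. blinfun_apply (q n) x) \<longlonglongrightarrow> 0" for x
  proof -
    have "(\<lambda>n. (1 / 2) *\<^sub>R (blinfun_apply (g n) x - F x)) \<longlonglongrightarrow> (1 / 2) *\<^sub>R (F x - F x)"
      by (intro tendsto_intros F)
    then show ?thesis
      by (simp add: q_def blinfun.scaleR_left blinfun.diff_left)
  qed
  have "q n \<in> dual smul" for n
    using g(1)[of n] F(1) by (simp add: q_def dual_def blinfun.scaleR_left blinfun.diff_left algebra_simps)
  moreover have "norm (q n) \<le> 1" for n
    using norm_triangle_ineq4[of "g n" F] g(2)[of n] F(2) by (simp add: q_def)
  ultimately have q: "q \<in> weak_star_null_seqs smul"
    using q0 by (simp add: weak_star_null_seqs_iff)
  define C where "C = (INF z\<in>cbs f. ca z)"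
  have "C / 8 \<le> beta smul p" if p: "p \<in> cbs q" for p
  proof -
    have pq: "subord p q"
      using p by (rule subord_if_cbs)
    \<comment> \<open>The affine map \<open>v\<close> to \<open>F + 2 v\<close> sends
      \<open>q\<close> back to \<open>g\<close> and commutes with convex hulls, so blocks of
      \<open>q\<close> become blocks of \<open>g\<close>.\<close>
    have "subord (\<lambda>n. F + 2 *\<^sub>R p n) g"
      unfolding subord_def
    proof
      fix n
      have "F + 2 *\<^sub>R p n \<in> (\<lambda>v. F + 2 *\<^sub>R v) ` (convex hull (q ` {n..}))"
        using pq by (simp add: subord_def)
      also have "\<dots> = convex hull ((\<lambda>v. F + 2 *\<^sub>R v) ` q ` {n..})"
        by (rule convex_hull_affinity[symmetric])
      also have "(\<lambda>v. F + 2 *\<^sub>R v) ` q ` {n..} = g ` {n..}"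
        by (simp add: image_image q_def)
      finally show "F + 2 *\<^sub>R p n \<in> convex hull (g ` {n..})" .
    qed
    \<comment> \<open>Overlapping blocks give membership in \<open>cbs f\<close> only after passing
      to a subsequence; one such member suffices to bound the infimum \<open>C\<close>.\<close>
    then obtain k where k: "strict_mono (k :: nat \<Rightarrow> nat)" "(\<lambda>n. F + 2 *\<^sub>R p n) \<circ> k \<in> cbs f"
      using subord_imp_subseq_cbs[OF subord_trans[OF _ gf]] by blast
    have "C \<le> ca (\<lambda>n. F + 2 *\<^sub>R p (k n))"
      unfolding C_def using k(2) by (intro INF_lower) (simp add: o_def)
    also have "\<dots> \<le> 4 * limsup (\<lambda>n. ereal (norm (p n)))"
      by (rule ca_le_limsup_norm[OF k(1)])
    also have "\<dots> \<le> 4 * (2 * beta smul p)"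
      by (intro ereal_mult_left_mono limsup_norm_le_beta[OF no] subord_limit[OF pq q0]) simp
    also have "\<dots> = 8 * beta smul p"
      by (simp flip: mult.assoc)
    finally show ?thesis
      by (subst ereal_divide_le_pos) simp_all
  qed
  then have "C / 8 \<le> (INF p\<in>cbs q. beta smul p)"
    by (rule INF_greatest)
  also have "\<dots> \<le> K2 smul"
    unfolding K2_def using q by (rule SUP_upper)
  finally show "C \<le> 8 * K2 smul"
    by (subst (asm) ereal_divide_le_pos) simp_all
qed

end

theorem theorem4p13:
  fixes smul :: "'k::real_or_complex \<Rightarrow> 'x::banach \<Rightarrow> 'x"
  assumes "banach_space_over smul"
    and "infinite_dimensional smul"
    and "\<not> contains_l1 smul"
  shows "K1 smul \<le> G smul \<and> G smul \<le> R (dual smul) \<and> R (dual smul) \<le> 8 * K2 smul"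
  using banach_space_over.K1_le_G[OF assms(1)] banach_space_over.G_le_R[OF assms(1)]
    banach_space_over.R_le_K2[OF assms(1,3)] by blast

end
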